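(* Let $G$ be a $d$-regular graph on $n$ vertices, where $d = d(n)$ satisfies $d = o(n/(\log n)^{12})$ as $n \to \infty$. Let $H = H(G)$ be the irregular random subgraph of $G$. Then with probability tending to $1$ as $n\to\infty$, for every integer $0 \le k \le d$, the number of vertices of degree $k$ in $H$ is $(1+o(1))\,n/(d+1)$.
   Context: The irregular random subgraph $H=H(G)$ of a graph $G$ is the random spanning subgraph obtained as follows: independently for each vertex $v\in V(G)$ choose $x(v)\in[0,1]$ uniformly at random, and let an edge $uv$ of $G$ be an edge of $H$ if and only if $x(u)+x(v)\ge 1$. *)

theory Defs
  imports "HOL-Probability.Probability" "HOL-Library.Landau_Symbols"
begin

definition simple_graph :: "'a set \<Rightarrow> 'a set set \<Rightarrow> bool" where
  "simple_graph V E \<longleftrightarrow> finite V \<and> (\<forall>e\<in>E. e \<subseteq> V \<and> card e = 2)"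

definition degree :: "'a set set \<Rightarrow> 'a \<Rightarrow> nat" where
  "degree E v = card {e \<in> E. v \<in> e}"

definition regular_graph :: "nat \<Rightarrow> 'a set \<Rightarrow> 'a set set \<Rightarrow> bool" where
  "regular_graph d V E \<longleftrightarrow> simple_graph V E \<and> (\<forall>v\<in>V. degree E v = d)"

definition num_of_degree :: "'a set \<Rightarrow> 'a set set \<Rightarrow> nat \<Rightarrow> nat" where
  "num_of_degree V E k = card {v \<in> V. degree E v = k}"

definition vertex_weights :: "'a set \<Rightarrow> ('a \<Rightarrow> real) measure" where
  "vertex_weights V = (\<Pi>\<^sub>M v\<in>V. uniform_measure lborel {0..1})"

(* The random subgraph H(G) is spanning: its vertex set is that of G, and its edge set is
   irregular_subgraph E x with x drawn from vertex_weights V. *)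
definition irregular_subgraph :: "'a set set \<Rightarrow> ('a \<Rightarrow> real) \<Rightarrow> 'a set set" where
  "irregular_subgraph E x = {{u, v} | u v. {u, v} \<in> E \<and> x u + x v \<ge> 1}"

end

(* Order the vertices by a(v) = min (x(v)) (1 - x(v)) and call v a plus vertex if x(v) > 1/2.
   An edge survives in H exactly when the endpoint with the smaller a is a plus vertex, and the
   order and the signs are uniform and independent. Expose the vertices in this order. Given the
   past, a vertex with p earlier plus neighbours and b neighbours to come has final degree uniform
   on {p..p+b}, so

     D = #{settled vertices of degree k} + sum of 1/(b_v + 1) over unsettled v with p_v <= k <= p_v + b_v

   is a martingale going from n/(d+1) to the number of vertices of degree k. As long as all
   vertices have comparable numbers of neighbours to come, up to a factor K of order log n, its
   steps are at most K + 1, and the absolute increments are controlled by D itself, so an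
   exponential supermartingale gives a Freedman-type bound of order exp (- n/(d+1) / polylog n). The
   comparability can fail for u, v only after a point where the last K vertices of the symmetric
   difference of N(u) and N(v) have conditional probability at least 1/e to lie all in N(u),
   whereas initially this probability is at most 2^-K. *)
theory Submission
  imports Defs
begin

section \<open>The random exposure process\<close>

text \<open>The probability that a vertex with \<open>p\<close> earlier plus neighbours and \<open>b\<close> neighbours still to
  come ends with degree \<open>k\<close>: its final degree is uniform on \<open>{p..p + b}\<close>.\<close>

definition hit_prob :: "nat \<Rightarrow> nat \<Rightarrow> nat \<Rightarrow> real" where
  "hit_prob k p b = (if p \<le> k \<and> k \<le> p + b then 1 / (real b + 1) else 0)"

text \<open>Counts the signs under which a vertex exposed now ends with degree \<open>k\<close>: a
  minus gives \<open>p\<close>, a plus gives \<open>p + b\<close>. For \<open>b = 0\<close> both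
  signs count.\<close>

definition ends :: "nat \<Rightarrow> nat \<Rightarrow> nat \<Rightarrow> real" where
  "ends k p b = of_bool (p = k) + of_bool (p + b = k)"

lemma hit_prob_nonneg: "0 \<le> hit_prob k p b"
  by (simp add: hit_prob_def)

lemma hit_prob_le: "hit_prob k p b \<le> 1 / (real b + 1)"
  by (simp add: hit_prob_def)

lemma times_hit_prob:
  "(real b + 1) * hit_prob k p b = of_bool (p \<le> k \<and> k \<le> p + b)"
  "b > 0 \<Longrightarrow> real b * hit_prob k p (b - Suc 0) = of_bool (p \<le> k \<and> k < p + b)"
  by (auto simp: hit_prob_def of_nat_diff)

text \<open>Martingale identity for one vertex, scaled by \<open>2 * (b + 1)\<close>: the first to
  be exposed among the vertex and its \<open>b\<close> open neighbours is uniform and has a fair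
  sign. For \<open>b = 0\<close> the truncated \<open>b - 1\<close> is multiplied by 0.\<close>

lemma hit_prob_rec:
  "ends k p b + real b * (hit_prob k (p + 1) (b - 1) + hit_prob k p (b - 1)) =
    2 * ((real b + 1) * hit_prob k p b)"
proof (cases "b = 0")
  case True
  then show ?thesis by (auto simp: hit_prob_def ends_def)
next
  case False
  then show ?thesis
    by (simp add: distrib_left times_hit_prob) (auto simp: ends_def)
qed

text \<open>Exposing a neighbour cuts one end off the range \<open>{p..p + b}\<close>: the lower end
  for a plus, the upper end for a minus. The value changes by \<open>1 / (b + 1)\<close> if
  \<open>k\<close> is the lost end, and elsewhere in the range only by
  \<open>1 / b - 1 / (b + 1)\<close>. So even the total over all \<open>b\<close> neighbours and
  both signs is of the order of \<open>ends\<close> and \<open>hit_prob\<close>.\<close>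

lemma hit_prob_diff:
  assumes "b > 0"
  shows "\<bar>hit_prob k (p + 1) (b - 1) - hit_prob k p b\<bar> \<le> 1 / (real b + 1)"
    "\<bar>hit_prob k p (b - 1) - hit_prob k p b\<bar> \<le> 1 / (real b + 1)"
    "real b * (\<bar>hit_prob k (p + 1) (b - 1) - hit_prob k p b\<bar> + \<bar>hit_prob k p (b - 1) - hit_prob k p b\<bar>)
      \<le> ends k p b + 2 * hit_prob k p b"
proof -
  define g where "g = 1 / (real b + 1)"
  have g: "0 < g" "1 / real b - g = g / real b" "g / real b \<le> g" "real b * g \<le> 1" "real b * (g / real b) = g"
  proof -
    have "real b > 0" "real b + 1 > 0" using assms by auto
    then show "0 < g" "1 / real b - g = g / real b" "g / real b \<le> g" "real b * g \<le> 1" "real b * (g / real b) = g"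
      using assms divide_left_mono[of 1 "real b" g] by (auto simp: g_def diff_frac_eq)
  qed
  have h: "hit_prob k p b = of_bool (p \<le> k \<and> k \<le> p + b) * g"
    "hit_prob k (p + 1) (b - 1) = of_bool (p < k \<and> k \<le> p + b) * (1 / real b)"
    "hit_prob k p (b - 1) = of_bool (p \<le> k \<and> k < p + b) * (1 / real b)"
    using assms by (auto simp: hit_prob_def g_def of_nat_diff)
  have d: "\<bar>hit_prob k (p + 1) (b - 1) - hit_prob k p b\<bar> =
      (if p = k then g else if p \<le> k \<and> k \<le> p + b then g / real b else 0)"
    "\<bar>hit_prob k p (b - 1) - hit_prob k p b\<bar> =
      (if p + b = k then g else if p \<le> k \<and> k \<le> p + b then g / real b else 0)"
    unfolding h using g by auto
  show "\<bar>hit_prob k (p + 1) (b - 1) - hit_prob k p b\<bar> \<le> 1 / (real b + 1)"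
    "\<bar>hit_prob k p (b - 1) - hit_prob k p b\<bar> \<le> 1 / (real b + 1)"
    unfolding d g_def[symmetric] using g by auto
  show "real b * (\<bar>hit_prob k (p + 1) (b - 1) - hit_prob k p b\<bar> + \<bar>hit_prob k p (b - 1) - hit_prob k p b\<bar>)
      \<le> ends k p b + 2 * hit_prob k p b"
    unfolding d distrib_left unfolding ends_def h(1) using g assms by auto
qed

lemma exp_le_quadratic:
  fixes y :: real assumes "\<bar>y\<bar> \<le> 1" shows "exp y \<le> 1 + y + y\<^sup>2"
proof (cases "0 \<le> y")
  case True then show ?thesis using exp_bound[of y] assms by auto
next
  case False
  then have "- y \<in> {0..1}" using assms by auto
  have "exp y * (1 - y) \<le> exp y * exp (-y)"
    by (intro mult_left_mono) (use exp_ge_add_one_self[of "-y"] in auto)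
  then have "exp y \<le> 1 / (1 - y)" using False by (simp add: field_simps flip: exp_add)
  also have "\<dots> \<le> 1 + y + y\<^sup>2"
  proof -
    have "(1 + y + y\<^sup>2) * (1 - y) = 1 - y ^ 3" by (simp add: algebra_simps power2_eq_square power3_eq_cube)
    moreover have "y ^ 3 \<le> 0" using False by (simp add: power3_eq_cube mult_nonneg_nonpos)
    ultimately show ?thesis using False by (simp add: pos_divide_le_eq)
  qed
  finally show ?thesis .
qed

section \<open>Runs at the end of a random order\<close>

text \<open>The probability that the last \<open>K\<close> elements of \<open>X \<union> Y\<close> in a random order of \<open>A\<close> all lie in \<open>X\<close>;
  it is \<open>0\<close> when fewer than \<open>K\<close> elements of \<open>X \<union> Y\<close> are left, because \<open>0 / 0 = 0\<close>.\<close>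

definition run_prob :: "nat \<Rightarrow> 'a set \<Rightarrow> 'a set \<Rightarrow> 'a set \<Rightarrow> real" where
  "run_prob K X Y A = real (card (X \<inter> A) choose K) / real (card ((X \<union> Y) \<inter> A) choose K)"

text \<open>Delete a uniformly random element of an \<open>s\<close>-set with \<open>x\<close>
  marked elements. For \<open>K < s\<close> the chance that the last \<open>K\<close> elements are
  all marked is preserved on average, with equality. For \<open>s \<le> K\<close> the denominators
  on the left are 0, so the left side vanishes.\<close>

lemma binomial_ratio_step:
  assumes "x \<le> s" 
  shows "real x * (real ((x - 1) choose K) / real ((s - 1) choose K)) +
         real (s - x) * (real (x choose K) / real ((s - 1) choose K))
       \<le> real s * (real (x choose K) / real (s choose K))"
proof (cases "K < s")
  case False
  then have "K \<ge> s" by simp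
  show ?thesis
  proof (cases "s = 0")
    case True then show ?thesis using assms by simp
  next
    case False
    then have "(s - 1) choose K = 0" using \<open>K \<ge> s\<close> by (simp add: binomial_eq_0)
    then show ?thesis by (simp only: of_nat_0 div_by_0 mult_zero_right) simp
  qed
next
  case True
  then obtain t where s: "s = Suc t" by (cases s) auto
  have *: "(Suc n - K) * (Suc n choose K) = Suc n * (n choose K)" for n
    using binomial_absorb_comp[of "Suc n" K] by simp
  have pos: "real (t choose K) > 0" "real (s choose K) > 0" using True s by auto
  have t1: "real (s - K) * real (s choose K) = real s * real (t choose K)"
    using *[of t] s by (metis of_nat_mult)
  \<comment> \<open>The factor \<open>x - K\<close> is a real difference, negative for
    \<open>x < K\<close>; there both binomials are 0.\<close>
  have x1: "real x * real ((x - 1) choose K) = (real x - real K) * real (x choose K)"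
  proof (cases "x \<ge> K")
    case True then show ?thesis
    proof (cases x)
      case (Suc y)
      then show ?thesis using *[of y] True 
        by (metis of_nat_mult of_nat_diff diff_Suc_1)
    qed (use True in auto)
  qed (auto simp: binomial_eq_0)
  have "real x * real ((x - 1) choose K) + real (s - x) * real (x choose K) = real (s - K) * real (x choose K)"
    using x1 assms True by (simp add: of_nat_diff algebra_simps)
  then have "real x * (real ((x - 1) choose K) / real (t choose K)) +
         real (s - x) * (real (x choose K) / real (t choose K)) = real (s - K) * real (x choose K) / real (t choose K)"
    by (simp flip: add_divide_distrib)
  also have "\<dots> = real s * (real (x choose K) / real (s choose K))"
  proof -
    have "real (s - K) = real s * real (t choose K) / real (s choose K)"
      using t1 pos by (simp only: nonzero_eq_divide_eq) 
    then show ?thesis using pos by (simp only:) simp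
  qed
  finally show ?thesis using s by simp
qed

text \<open>Elements of \<open>A\<close> outside \<open>X \<union> Y\<close> leave the ratio
  unchanged when deleted; deletions inside are the case of
  \<open>binomial_ratio_step\<close>.\<close>

lemma run_prob_supermartingale:
  assumes "finite A" "X \<inter> Y = {}"
  shows "(\<Sum>u\<in>A. run_prob K X Y (A - {u})) \<le> real (card A) * run_prob K X Y A"
proof -
  define x s where "x = card (X \<inter> A)" and "s = card ((X \<union> Y) \<inter> A)"
  have xs: "x \<le> s" unfolding x_def s_def using assms by (intro card_mono) auto
  have sA: "s \<le> card A" unfolding s_def using assms by (intro card_mono) auto
  have y: "card (Y \<inter> A) = s - x"
  proof -
    have "s = x + card (Y \<inter> A)" unfolding x_def s_def Int_Un_distrib2
      using assms by (intro card_Un_disjoint) auto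
    then show ?thesis by simp
  qed
  have minus: "card (Z \<inter> (A - {u})) = (if u \<in> Z then card (Z \<inter> A) - 1 else card (Z \<inter> A))" if "u \<in> A" for Z u
  proof -
    have "Z \<inter> (A - {u}) = (Z \<inter> A) - {u}" by auto
    then show ?thesis using that assms by simp
  qed
  let ?r = "\<lambda>x s. real (x choose K) / real (s choose K)"
  have "(\<Sum>u\<in>A. run_prob K X Y (A - {u})) =
     (\<Sum>u\<in>A. if u \<in> X then ?r (x - 1) (s - 1) else if u \<in> Y then ?r x (s - 1) else ?r x s)"
    by (intro sum.cong refl) (use assms in \<open>auto simp: run_prob_def minus x_def s_def\<close>)
  also have "\<dots> = real x * ?r (x - 1) (s - 1) + real (s - x) * ?r x (s - 1) + real (card A - s) * ?r x s"
  proof -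
    have A: "A = (X \<inter> A) \<union> ((Y \<inter> A) \<union> (A - (X \<union> Y)))" by auto
    have "card (A - (X \<union> Y)) = card A - s"
    proof -
      have "A - (X \<union> Y) = A - (X \<union> Y) \<inter> A" by auto
      then show ?thesis unfolding s_def using assms by (metis card_Diff_subset finite_Int Int_lower2)
    qed
    note cs = this y x_def[symmetric]
    let ?f = "\<lambda>u. if u \<in> X then ?r (x - 1) (s - 1) else if u \<in> Y then ?r x (s - 1) else ?r x s"
    have "sum ?f A = sum ?f (X \<inter> A) + (sum ?f (Y \<inter> A) + sum ?f (A - (X \<union> Y)))"
      by (subst A, (subst sum.union_disjoint; use assms in auto)+)
    moreover have "sum ?f (X \<inter> A) = (\<Sum>u\<in>X \<inter> A. ?r (x - 1) (s - 1))"
      by (intro sum.cong) auto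
    moreover have "sum ?f (Y \<inter> A) = (\<Sum>u\<in>Y \<inter> A. ?r x (s - 1))"
      using assms by (intro sum.cong) auto
    moreover have "sum ?f (A - (X \<union> Y)) = (\<Sum>u\<in>A - (X \<union> Y). ?r x s)"
      by (intro sum.cong) auto
    ultimately show ?thesis by (simp only: cs sum_constant)
  qed
  also have "\<dots> \<le> real s * ?r x s + real (card A - s) * ?r x s"
    using binomial_ratio_step[OF xs, of K] by simp
  also have "\<dots> = real (card A) * run_prob K X Y A"
    using sA by (simp add: run_prob_def x_def[symmetric] s_def[symmetric] of_nat_diff flip: distrib_right add_divide_distrib)
  finally show ?thesis .
qed

lemma binomial_ratio_prod:
  assumes "K \<le> x" "x \<le> s"
  shows "real (x choose K) / real (s choose K) = (\<Prod>i<K. (real x - real i) / (real s - real i))"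
proof -
  have "real (m choose K) = (\<Prod>i<K. real m - real i) / fact K" for m
    by (simp add: binomial_gbinomial gbinomial_prod_rev atLeast0LessThan)
  then show ?thesis by (simp add: prod_dividef)
qed

text \<open>With \<open>X\<close> and \<open>Y\<close> of equal size \<open>x\<close>, every factor
  of the product form is \<open>(x - i) / (2 * x - i) \<le> 1/2\<close>. If \<open>K > x\<close>,
  the numerator is 0.\<close>

lemma run_prob_initial:
  assumes "finite X" "finite Y" "card X = card Y" "X \<inter> Y = {}" "X \<subseteq> A" "Y \<subseteq> A"
  shows "run_prob K X Y A \<le> (1/2) ^ K"
proof -
  have e: "X \<inter> A = X" "(X \<union> Y) \<inter> A = X \<union> Y" using assms by auto
  have c: "card (X \<union> Y) = 2 * card X" using assms by (simp add: card_Un_disjoint)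
  show ?thesis
  proof (cases "K \<le> card X")
    case True
    have "(\<Prod>i<K. (real (card X) - real i) / (real (2 * card X) - real i)) \<le> (\<Prod>i<K. 1/2)"
      by (intro prod_mono) (use True in \<open>auto simp: field_simps\<close>)
    then show ?thesis unfolding run_prob_def e c
      using True by (subst binomial_ratio_prod) auto
  next
    case False
    then show ?thesis by (simp add: run_prob_def e binomial_eq_0)
  qed
qed

text \<open>For \<open>i < K\<close> the hypothesis leaves more than \<open>K * y\<close> elements
  of \<open>X\<close> after \<open>i\<close> are taken, so each of the \<open>K\<close> factors is
  at least \<open>K / (K + 1)\<close>. The claim follows from
  \<open>(1 + 1 / K) ^ K \<le> exp 1\<close>.\<close>

lemma run_prob_lower:
  assumes "finite A" "X \<inter> Y = {}" "K > 0" and big: "card (X \<inter> A) > K * (card (Y \<inter> A) + 1)"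
  shows "exp 1 * run_prob K X Y A \<ge> 1"
proof -
  define x y where "x = card (X \<inter> A)" and "y = card (Y \<inter> A)"
  have s: "card ((X \<union> Y) \<inter> A) = x + y" unfolding x_def y_def Int_Un_distrib2
      using assms by (intro card_Un_disjoint) auto
  have Kx: "K \<le> x" and xb: "x > K * y + K" using big by (auto simp: x_def y_def)
  have "(real K / (real K + 1)) ^ K = (\<Prod>i<K. real K / (real K + 1))" by simp
  also have "\<dots> \<le> (\<Prod>i<K. (real x - real i) / (real (x + y) - real i))"
  proof (intro prod_mono conjI)
    fix i assume i: "i \<in> {..<K}"
    have "real x > real K * real y + real K" using xb by (metis of_nat_less_iff of_nat_add of_nat_mult)
    moreover have "real i < real K" "0 \<le> real K * real y" using i by auto
    ultimately have "real K * real y \<le> real x - real i" "real i < real x" by linarith+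
    then show "real K / (real K + 1) \<le> (real x - real i) / (real (x + y) - real i)"
      by (simp add: field_simps)
  qed auto
  also have "\<dots> = run_prob K X Y A"
    unfolding run_prob_def s x_def[symmetric] using Kx by (subst binomial_ratio_prod) auto
  finally have 1: "(real K / (real K + 1)) ^ K \<le> run_prob K X Y A" .
  have "((real K + 1) / real K) ^ K \<le> exp (1 / real K) ^ K"
    by (intro power_mono) (use assms exp_ge_add_one_self[of "1 / real K"] in \<open>auto simp: field_simps\<close>)
  also have "\<dots> = exp 1" using assms by (simp flip: exp_of_nat_mult)
  finally have "1 \<le> exp 1 * (real K / (real K + 1)) ^ K" using assms
    by (simp add: field_simps power_divide)
  also have "\<dots> \<le> exp 1 * run_prob K X Y A" using 1 by simp
  finally show ?thesis .
qed

text \<open>A pair \<open>(l, Q)\<close> encodes an exposure order and its set of plus vertices.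
  Splitting off the first vertex and its sign turns an average over such pairs into a recursion
  along the process.\<close>

lemma sum_permutations_Pow:
  fixes f :: "'a list \<Rightarrow> 'a set \<Rightarrow> real"
  assumes "finite A" "A \<noteq> {}"
  shows "(\<Sum>l\<in>permutations_of_set A. \<Sum>Q\<in>Pow A. f l Q) =
    (\<Sum>u\<in>A. \<Sum>l\<in>permutations_of_set (A - {u}). \<Sum>Q\<in>Pow (A - {u}). f (u # l) (insert u Q) + f (u # l) Q)"
proof -
  have pow: "(\<Sum>Q\<in>Pow A. g Q) = (\<Sum>Q\<in>Pow (A - {u}). g (insert u Q) + g Q)" if "u \<in> A" for u and g :: "'a set \<Rightarrow> real"
  proof -
    have A: "A = insert u (A - {u})" using that by auto
    have "(\<Sum>Q\<in>Pow A. g Q) = sum g (Pow (A - {u})) + sum g (insert u ` Pow (A - {u}))"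
      by (subst A, subst Pow_insert, subst sum.union_disjoint) (use assms in auto)
    also have "sum g (insert u ` Pow (A - {u})) = (\<Sum>Q\<in>Pow (A - {u}). g (insert u Q))"
      by (subst sum.reindex) (auto simp: inj_on_def)
    finally show ?thesis by (simp add: sum.distrib)
  qed
  have "(\<Sum>l\<in>permutations_of_set A. \<Sum>Q\<in>Pow A. f l Q) =
      (\<Sum>u\<in>A. \<Sum>l\<in>(#) u ` permutations_of_set (A - {u}). \<Sum>Q\<in>Pow A. f l Q)"
    unfolding permutations_of_set_nonempty[OF assms(2)]
    by (subst sum.UNION_disjoint) (use assms in auto)
  also have "\<dots> = (\<Sum>u\<in>A. \<Sum>l\<in>permutations_of_set (A - {u}). \<Sum>Q\<in>Pow A. f (u # l) Q)"
    by (simp add: sum.reindex)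
  also have "\<dots> = (\<Sum>u\<in>A. \<Sum>l\<in>permutations_of_set (A - {u}). \<Sum>Q\<in>Pow (A - {u}). f (u # l) (insert u Q) + f (u # l) Q)"
    by (intro sum.cong refl pow)
  finally show ?thesis .
qed

section \<open>The exposure martingale and its one-step estimates\<close>

locale regular_nbhds =
  fixes V :: "'a set" and N :: "'a \<Rightarrow> 'a set" and d :: nat
  assumes finite_V: "finite V"
    and N_subset: "v \<in> V \<Longrightarrow> N v \<subseteq> V"
    and N_sym: "u \<in> N v \<longleftrightarrow> v \<in> N u"
    and N_irrefl: "v \<notin> N v"
    and card_N: "v \<in> V \<Longrightarrow> card (N v) = d"
begin

text \<open>\<open>A\<close> is the set of vertices still to come and \<open>P\<close> the set of earlier plus vertices.
  The number of settled vertices of degree \<open>k\<close> plus \<open>potential k A P\<close> is a martingale.\<close>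

definition potential :: "nat \<Rightarrow> 'a set \<Rightarrow> 'a set \<Rightarrow> real" where
  "potential k A P = (\<Sum>v\<in>A. hit_prob k (card (N v \<inter> P)) (card (N v \<inter> A)))"

text \<open>The earlier endpoint decides each edge, so exposing \<open>u\<close> with sign
  \<open>s\<close> fixes its final degree: earlier plus neighbours always count, later neighbours
  count exactly for a plus.\<close>

definition settles :: "nat \<Rightarrow> 'a set \<Rightarrow> 'a set \<Rightarrow> bool \<Rightarrow> 'a \<Rightarrow> bool" where
  "settles k A P s u \<longleftrightarrow> card (N u \<inter> P) + (if s then card (N u \<inter> A) else 0) = k"

text \<open>The step of the martingale when \<open>u\<close> is exposed with sign
  \<open>s\<close>.\<close>

definition increment :: "nat \<Rightarrow> 'a set \<Rightarrow> 'a set \<Rightarrow> bool \<Rightarrow> 'a \<Rightarrow> real" where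
  "increment k A P s u = of_bool (settles k A P s u) +
     potential k (A - {u}) (if s then insert u P else P) - potential k A P"

text \<open>The \<open>+ 1\<close> matches the denominator of \<open>hit_prob\<close>: up to
  \<open>b\<close> open neighbours, each changing by at most \<open>1 / (b' + 1)\<close>, contribute
  at most \<open>K\<close> in total.\<close>

definition balanced :: "nat \<Rightarrow> 'a set \<Rightarrow> bool" where
  "balanced K A \<longleftrightarrow> (\<forall>u\<in>V. \<forall>v\<in>V. card (N u \<inter> A) \<le> K * (card (N v \<inter> A) + 1))"

lemma potential_nonneg: "0 \<le> potential k A P"
  unfolding potential_def by (intro sum_nonneg hit_prob_nonneg)

context
  fixes A P :: "'a set"
  assumes AV: "A \<subseteq> V" and PA: "P \<inter> A = {}" and finP: "finite P"
begin

lemma finite_A: "finite A" using AV finite_V finite_subset by blast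

definition plus_deg where "plus_deg v = card (N v \<inter> P)"
definition open_deg where "open_deg v = card (N v \<inter> A)"

lemma open_deg_pos: "u \<in> A \<Longrightarrow> v \<in> N u \<inter> A \<Longrightarrow> open_deg v > 0"
  using finite_A N_sym[of u v] by (auto simp: open_deg_def card_gt_0_iff)

text \<open>Exposing \<open>u\<close> removes its own term from the potential and otherwise touches
  only its open neighbours: each loses one open neighbour and, if \<open>s\<close> holds, gains a
  plus neighbour.\<close>

lemma increment_eq:
  assumes u: "u \<in> A"
  shows "increment k A P s u = of_bool (settles k A P s u) - hit_prob k (plus_deg u) (open_deg u) +
    (\<Sum>v\<in>N u \<inter> A. hit_prob k (plus_deg v + of_bool s) (open_deg v - 1) - hit_prob k (plus_deg v) (open_deg v))"
proof -
  let ?P = "if s then insert u P else P"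
  have uP: "u \<notin> P" using u PA by auto
  have b: "card (N v \<inter> (A - {u})) = (if v \<in> N u then open_deg v - 1 else open_deg v)" for v
  proof -
    have "N v \<inter> (A - {u}) = (N v \<inter> A) - {u}" by auto
    then show ?thesis using u finite_A N_sym[of u v] by (auto simp: open_deg_def)
  qed
  have p: "card (N v \<inter> ?P) = (if v \<in> N u then plus_deg v + of_bool s else plus_deg v)" for v
  proof -
    have "N v \<inter> insert u P = (if u \<in> N v then insert u (N v \<inter> P) else N v \<inter> P)" by auto
    then show ?thesis using uP finP N_sym[of u v] by (auto simp: plus_deg_def)
  qed
  have 1: "potential k (A - {u}) ?P = (\<Sum>v\<in>A - {u}. if v \<in> N u then hit_prob k (plus_deg v + of_bool s) (open_deg v - 1) else hit_prob k (plus_deg v) (open_deg v))"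
    unfolding potential_def by (intro sum.cong refl) (simp only: b p split: if_splits, simp)
  have 2: "potential k A P = hit_prob k (plus_deg u) (open_deg u) + (\<Sum>v\<in>A - {u}. hit_prob k (plus_deg v) (open_deg v))"
    unfolding potential_def plus_deg_def open_deg_def using u finite_A by (subst sum.remove[of _ u]) auto
  have 3: "potential k (A - {u}) ?P - potential k A P = - hit_prob k (plus_deg u) (open_deg u) + 
     (\<Sum>v\<in>A - {u}. if v \<in> N u then hit_prob k (plus_deg v + of_bool s) (open_deg v - 1) - hit_prob k (plus_deg v) (open_deg v) else 0)"
  proof -
    have "X - (h + S) = - h + (X - S)" for X h S :: real by simp
    then show ?thesis unfolding 1 2
      by (simp only: sum_subtractf[symmetric]) (intro arg_cong2[where f = "(+)"] refl sum.cong, auto)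
  qed
  also have "(\<Sum>v\<in>A - {u}. if v \<in> N u then hit_prob k (plus_deg v + of_bool s) (open_deg v - 1) - hit_prob k (plus_deg v) (open_deg v) else 0)
    = (\<Sum>v\<in>N u \<inter> A. hit_prob k (plus_deg v + of_bool s) (open_deg v - 1) - hit_prob k (plus_deg v) (open_deg v))"
  proof -
    have "N u \<inter> A = {v \<in> A - {u}. v \<in> N u}" using N_irrefl by auto
    then show ?thesis using finite_A by (simp add: sum.inter_filter[symmetric])
  qed
  finally show ?thesis by (simp add: increment_def)
qed

text \<open>Double counting, by symmetry of \<open>N\<close>.\<close>

lemma sum_nbhd: "(\<Sum>u\<in>A. \<Sum>v\<in>N u \<inter> A. f v) = (\<Sum>v\<in>A. real (open_deg v) * f v)"
proof -
  have "(\<Sum>u\<in>A. \<Sum>v\<in>N u \<inter> A. f v) = (\<Sum>u\<in>A. \<Sum>v\<in>{v\<in>A. v \<in> N u}. f v)"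
    by (intro sum.cong) auto
  also have "\<dots> = (\<Sum>v\<in>A. \<Sum>u\<in>{u\<in>A. v \<in> N u}. f v)"
    by (rule sum.swap_restrict) (use finite_A in auto)
  also have "\<dots> = (\<Sum>v\<in>A. real (open_deg v) * f v)"
  proof (intro sum.cong refl)
    fix v
    have "{u \<in> A. v \<in> N u} = N v \<inter> A" using N_sym by auto
    then show "(\<Sum>u\<in>{u\<in>A. v \<in> N u}. f v) = real (open_deg v) * f v" by (simp add: open_deg_def)
  qed
  finally show ?thesis .
qed

lemma sum_add_nbhd: "(\<Sum>u\<in>A. g u + (\<Sum>v\<in>N u \<inter> A. f v)) = (\<Sum>v\<in>A. g v + real (open_deg v) * f v)"
  by (simp only: sum.distrib sum_nbhd)

lemma settles_ends: "of_bool (settles k A P True u) + of_bool (settles k A P False u) = ends k (plus_deg u) (open_deg u)"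
  by (simp add: settles_def ends_def plus_deg_def open_deg_def)

text \<open>The martingale property, summed over the \<open>2 * card A\<close> equally likely
  choices. Collecting the terms vertex by vertex reduces it to \<open>hit_prob_rec\<close>.\<close>

lemma sum_increment: "(\<Sum>u\<in>A. increment k A P True u + increment k A P False u) = 0"
proof -
  let ?h = "\<lambda>v. hit_prob k (plus_deg v) (open_deg v)"
  let ?g = "\<lambda>v. hit_prob k (plus_deg v + 1) (open_deg v - 1) + hit_prob k (plus_deg v) (open_deg v - 1) - 2 * ?h v"
  have "(\<Sum>u\<in>A. increment k A P True u + increment k A P False u) =
    (\<Sum>u\<in>A. (ends k (plus_deg u) (open_deg u) - 2 * ?h u) + (\<Sum>v\<in>N u \<inter> A. ?g v))"
    unfolding settles_ends[symmetric]
    by (intro sum.cong refl) (simp add: increment_eq sum.distrib sum_subtractf sum_distrib_left sum_negf)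
  also have "\<dots> = (\<Sum>v\<in>A. (ends k (plus_deg v) (open_deg v) - 2 * ?h v) + real (open_deg v) * ?g v)"
    by (rule sum_add_nbhd)
  also have "\<dots> = (\<Sum>v\<in>A. 0)"
    using hit_prob_rec[of k "plus_deg _" "open_deg _"] by (intro sum.cong) (auto simp: algebra_simps)
  finally show ?thesis by simp
qed

text \<open>The same regrouping with \<open>hit_prob_diff\<close> in place of
  \<open>hit_prob_rec\<close>. Besides the potential, only the number of choices that settle a
  vertex at degree \<open>k\<close> enters.\<close>

lemma sum_abs_increment:
  "(\<Sum>u\<in>A. \<bar>increment k A P True u\<bar> + \<bar>increment k A P False u\<bar>) \<le> 2 * (\<Sum>u\<in>A. ends k (plus_deg u) (open_deg u)) + 4 * potential k A P"
proof -
  let ?h = "\<lambda>v. hit_prob k (plus_deg v) (open_deg v)"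
  let ?g = "\<lambda>v. \<bar>hit_prob k (plus_deg v + 1) (open_deg v - 1) - ?h v\<bar> + \<bar>hit_prob k (plus_deg v) (open_deg v - 1) - ?h v\<bar>"
  have "(\<Sum>u\<in>A. \<bar>increment k A P True u\<bar> + \<bar>increment k A P False u\<bar>) \<le>
    (\<Sum>u\<in>A. (ends k (plus_deg u) (open_deg u) + 2 * ?h u) + (\<Sum>v\<in>N u \<inter> A. ?g v))"
  proof (intro sum_mono)
    fix u assume u: "u \<in> A"
    have "\<bar>increment k A P s u\<bar> \<le> of_bool (settles k A P s u) + ?h u + 
      (\<Sum>v\<in>N u \<inter> A. \<bar>hit_prob k (plus_deg v + of_bool s) (open_deg v - 1) - ?h v\<bar>)" for s
      unfolding increment_eq[OF u] using hit_prob_nonneg[of k "plus_deg u" "open_deg u"]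
        sum_abs[of "\<lambda>v. hit_prob k (plus_deg v + of_bool s) (open_deg v - 1) - ?h v" "N u \<inter> A"] by (auto simp: abs_le_iff)
    from this[of True] this[of False]
    show "\<bar>increment k A P True u\<bar> + \<bar>increment k A P False u\<bar> \<le> (ends k (plus_deg u) (open_deg u) + 2 * ?h u) + (\<Sum>v\<in>N u \<inter> A. ?g v)"
      unfolding settles_ends[symmetric] by (simp add: sum.distrib)
  qed
  also have "\<dots> = (\<Sum>v\<in>A. (ends k (plus_deg v) (open_deg v) + 2 * ?h v) + real (open_deg v) * ?g v)"
    by (rule sum_add_nbhd)
  also have "\<dots> \<le> (\<Sum>v\<in>A. 2 * ends k (plus_deg v) (open_deg v) + 4 * ?h v)"
  proof (intro sum_mono)
    fix v
    have "real (open_deg v) * ?g v \<le> ends k (plus_deg v) (open_deg v) + 2 * ?h v"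
      using hit_prob_diff(3)[of "open_deg v" k "plus_deg v"] hit_prob_nonneg[of k "plus_deg v" "open_deg v"]
      by (cases "open_deg v = 0") (auto simp: ends_def)
    then show "(ends k (plus_deg v) (open_deg v) + 2 * ?h v) + real (open_deg v) * ?g v \<le> 2 * ends k (plus_deg v) (open_deg v) + 4 * ?h v"
      by simp
  qed
  also have "\<dots> = 2 * (\<Sum>u\<in>A. ends k (plus_deg u) (open_deg u)) + 4 * potential k A P"
    by (simp add: sum.distrib sum_distrib_left potential_def plus_deg_def open_deg_def)
  finally show ?thesis .
qed

text \<open>Each open neighbour contributes at most \<open>K / open_deg u\<close> by balance, which
  sums to at most \<open>K\<close>; the term of \<open>u\<close> itself contributes at most
  1.\<close>

lemma abs_increment_le:
  assumes bal: "balanced K A" and u: "u \<in> A"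
  shows "\<bar>increment k A P s u\<bar> \<le> real K + 1"
proof -
  let ?h = "\<lambda>v. hit_prob k (plus_deg v) (open_deg v)"
  have "\<bar>\<Sum>v\<in>N u \<inter> A. hit_prob k (plus_deg v + of_bool s) (open_deg v - 1) - ?h v\<bar> \<le> (\<Sum>v\<in>N u \<inter> A. real K / real (open_deg u))"
  proof (rule order_trans[OF sum_abs], intro sum_mono)
    fix v assume v: "v \<in> N u \<inter> A"
    have b: "open_deg v > 0" using open_deg_pos[OF u v] .
    have "open_deg u > 0" using u v finite_A by (auto simp: open_deg_def card_gt_0_iff)
    have "open_deg u \<le> K * (open_deg v + 1)" using bal u v AV unfolding balanced_def open_deg_def by blast
    then have "real (open_deg u) \<le> real K * (real (open_deg v) + 1)"
      by (metis of_nat_1 of_nat_add of_nat_le_iff of_nat_mult)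
    then have "1 / (real (open_deg v) + 1) \<le> real K / real (open_deg u)"
      using \<open>open_deg u > 0\<close> by (simp add: field_simps)
    moreover have "\<bar>hit_prob k (plus_deg v + of_bool s) (open_deg v - 1) - ?h v\<bar> \<le> 1 / (real (open_deg v) + 1)"
      using hit_prob_diff(1,2)[OF b, of k "plus_deg v"] by (cases s) auto
    ultimately show "\<bar>hit_prob k (plus_deg v + of_bool s) (open_deg v - 1) - ?h v\<bar> \<le> real K / real (open_deg u)" by linarith
  qed
  also have "\<dots> \<le> real K" by (simp add: open_deg_def)
  finally have 1: "\<bar>\<Sum>v\<in>N u \<inter> A. hit_prob k (plus_deg v + of_bool s) (open_deg v - 1) - ?h v\<bar> \<le> real K" .
  have "?h u \<le> 1" by (rule order_trans[OF hit_prob_le]) simp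
  then have "\<bar>of_bool (settles k A P s u) - ?h u\<bar> \<le> 1"
    using hit_prob_nonneg[of k "plus_deg u" "open_deg u"] by (cases "settles k A P s u") auto
  with 1 show ?thesis unfolding increment_eq[OF u] by linarith
qed

text \<open>Expand the exponential to second order. Linear terms in the increments cancel by
  \<open>sum_increment\<close>; squares are at most \<open>J\<close> times absolute values, which
  \<open>sum_abs_increment\<close> controls. Since \<open>lam\<close> may have either sign, both
  tails are covered.\<close>

lemma step_mgf:
  fixes lam J th :: real
  assumes bal: "balanced K A" and J: "J = real K + 1" and th: "th = 8 * lam\<^sup>2 * J" "th \<le> 1/4"
    and lam: "\<bar>lam\<bar> * J \<le> 1/2" and potle: "potential k A P \<le> 2 * mu" and ne: "A \<noteq> {}"
  shows "(\<Sum>u\<in>A. exp (lam * increment k A P True u - th * of_bool (settles k A P True u)) +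
        exp (lam * increment k A P False u - th * of_bool (settles k A P False u)))
      \<le> 2 * real (card A) * exp (8 * lam\<^sup>2 * J * mu / real (card A))"
proof -
  define H where "H = (\<Sum>u\<in>A. ends k (plus_deg u) (open_deg u))"
  have H0: "H \<ge> 0" unfolding H_def ends_def by (intro sum_nonneg) auto
  have m: "real (card A) > 0" using ne finite_A by (auto simp: card_gt_0_iff)
  have J1: "J \<ge> 1" using J by simp
  have th0: "th \<ge> 0" using th J1 by simp
  let ?s = "\<lambda>s u. of_bool (settles k A P s u) :: real"
  let ?Y = "\<lambda>s u. lam * increment k A P s u - th * ?s s u"
  have pt: "exp (?Y s u) \<le> 1 + lam * increment k A P s u - th * ?s s u + 2 * lam\<^sup>2 * J * \<bar>increment k A P s u\<bar> + 2 * th\<^sup>2 * ?s s u"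
    if u: "u \<in> A" for s u
  proof -
    let ?i = "increment k A P s u"
    have i: "\<bar>?i\<bar> \<le> J" using abs_increment_le[OF bal u] J by simp
    have "\<bar>lam * ?i\<bar> \<le> 1/2" using mult_left_mono[OF i, of "\<bar>lam\<bar>"] lam by (simp add: abs_mult)
    \<comment> \<open>The increment contributes at most 1/2 and the penalty at most 1/4.\<close>
    then have "\<bar>?Y s u\<bar> \<le> 1" using th(2) th0 by (cases "settles k A P s u"; simp; linarith)
    then have "exp (?Y s u) \<le> 1 + ?Y s u + (?Y s u)\<^sup>2" by (rule exp_le_quadratic)
    moreover have "(?Y s u)\<^sup>2 \<le> 2 * (lam * ?i)\<^sup>2 + 2 * (th * ?s s u)\<^sup>2"
      using zero_le_power2[of "lam * ?i + th * ?s s u"] by (simp add: power2_sum power2_diff)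
    moreover have "(th * ?s s u)\<^sup>2 = th\<^sup>2 * ?s s u" by auto
    moreover have "?i\<^sup>2 \<le> J * \<bar>?i\<bar>"
      using mult_right_mono[OF i, of "\<bar>?i\<bar>"] by (simp add: power2_eq_square flip: abs_mult)
    then have "(lam * ?i)\<^sup>2 \<le> lam\<^sup>2 * (J * \<bar>?i\<bar>)" unfolding power_mult_distrib by (intro mult_left_mono) auto
    ultimately show ?thesis by linarith
  qed
  have "(\<Sum>u\<in>A. exp (?Y True u) + exp (?Y False u)) \<le>
     (\<Sum>u\<in>A. 2 + lam * (increment k A P True u + increment k A P False u) + (2 * th\<^sup>2 - th) * ends k (plus_deg u) (open_deg u)
        + 2 * lam\<^sup>2 * J * (\<bar>increment k A P True u\<bar> + \<bar>increment k A P False u\<bar>))"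
  proof (intro sum_mono)
    fix u assume "u \<in> A"
    from pt[OF this, of True] pt[OF this, of False]
    show "exp (?Y True u) + exp (?Y False u) \<le> 2 + lam * (increment k A P True u + increment k A P False u) + (2 * th\<^sup>2 - th) * ends k (plus_deg u) (open_deg u)
        + 2 * lam\<^sup>2 * J * (\<bar>increment k A P True u\<bar> + \<bar>increment k A P False u\<bar>)"
      unfolding settles_ends[symmetric] by (simp add: algebra_simps)
  qed
  also have "\<dots> = 2 * real (card A) + (2 * th\<^sup>2 - th) * H + 2 * lam\<^sup>2 * J * (\<Sum>u\<in>A. \<bar>increment k A P True u\<bar> + \<bar>increment k A P False u\<bar>)"
    using sum_increment[of k] unfolding H_def by (simp add: sum.distrib flip: sum_distrib_left)
  also have "\<dots> \<le> 2 * real (card A) + (2 * th\<^sup>2 - th) * H + 2 * lam\<^sup>2 * J * (2 * H + 4 * (2 * mu))"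
    using sum_abs_increment[of k] potle J1 unfolding H_def[symmetric] by (intro add_left_mono mult_left_mono) auto
  \<comment> \<open>The value of \<open>th\<close> is chosen so that the settling part of the
    quadratic term is \<open>th / 2 * H\<close>, half of the penalty. The remaining half absorbs
    \<open>2 * th\<^sup>2 * H\<close> because \<open>th \<le> 1/4\<close>.\<close>
  also have "\<dots> = 2 * real (card A) + (2 * th\<^sup>2 - th / 2) * H + 16 * lam\<^sup>2 * J * mu"
    unfolding th by (simp add: algebra_simps)
  also have "\<dots> \<le> 2 * real (card A) + 16 * lam\<^sup>2 * J * mu"
  proof -
    have "th * th \<le> th * (1/4)" using th th0 by (intro mult_left_mono) auto
    then have "(2 * th\<^sup>2 - th / 2) * H \<le> 0" using H0 by (intro mult_nonpos_nonneg) (auto simp: power2_eq_square)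
    then show ?thesis by simp
  qed
  also have "\<dots> = 2 * real (card A) * (1 + 8 * lam\<^sup>2 * J * mu / real (card A))"
    using m by (simp add: field_simps)
  also have "\<dots> \<le> 2 * real (card A) * exp (8 * lam\<^sup>2 * J * mu / real (card A))"
    using exp_ge_add_one_self m by (intro mult_left_mono) auto
  finally show ?thesis .
qed

end

end

text \<open>The degree count of H read off an exposure order and the set \<open>Q\<close> of plus
  vertices alone; \<open>P\<close> accumulates the plus vertices already exposed.\<close>

primrec count_degree :: "('a \<Rightarrow> 'a set) \<Rightarrow> nat \<Rightarrow> 'a set \<Rightarrow> 'a set \<Rightarrow> 'a list \<Rightarrow> nat" where
  "count_degree N k Q P [] = 0"
| "count_degree N k Q P (u # l) =
    of_bool (card (N u \<inter> P) + (if u \<in> Q then card (N u \<inter> set l) else 0) = k) +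
    count_degree N k Q (if u \<in> Q then insert u P else P) l"

lemma count_degree_cong:
  "Q \<inter> set l = Q' \<inter> set l \<Longrightarrow> count_degree N k Q P l = count_degree N k Q' P l"
proof (induction l arbitrary: P)
  case (Cons u l)
  then have "Q \<inter> set l = Q' \<inter> set l" "u \<in> Q \<longleftrightarrow> u \<in> Q'" by auto
  then show ?case using Cons.IH by simp
qed simp

section \<open>The exponential supermartingale and the deviation bound\<close>

lemma harm_le: "n > 0 \<Longrightarrow> harm n \<le> ln (real n) + 1"
  using euler_mascheroni_sequence_decreasing[of 1 n] by (simp add: harm_expand)

text \<open>\<open>lam\<close> is the exponent, \<open>J\<close> the bound on the steps,
  \<open>th\<close> the penalty per vertex settling at degree \<open>k\<close>, \<open>mu\<close>
  the starting value and \<open>eps\<close> the relative deviation. The bounds on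
  \<open>lam * J\<close> and \<open>th\<close> serve \<open>step_mgf\<close>;
  \<open>th \<le> lam\<close> keeps the upper tail exponent \<open>lam - th\<close>
  nonnegative.\<close>

locale regular_nbhds_params = regular_nbhds +
  fixes K :: nat and lam eps mu th J :: real
  assumes K: "K > 0" and J: "J = real K + 1" and th: "th = 8 * lam\<^sup>2 * J" "th \<le> 1/4" "th \<le> lam"
    and lam: "lam * J \<le> 1/2" and eps: "0 \<le> eps" "eps \<le> 1" and mu: "mu \<ge> 0"
begin

text \<open>The term \<open>- th * c\<close> makes the quadratic variation caused by vertices settling at degree \<open>k\<close> pay
  for itself; the harmonic number pays for the rest of it, which per step is at most of order
  \<open>potential k A P / card A\<close>.\<close>

definition exp_potential :: "real \<Rightarrow> nat \<Rightarrow> 'a set \<Rightarrow> 'a set \<Rightarrow> real \<Rightarrow> real" where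
  "exp_potential r k A P c = exp (r * (c + potential k A P - mu) - th * c + 8 * lam\<^sup>2 * J * mu * harm (card A))"

text \<open>A union bound over ordered pairs in the form of a supermartingale. The factor
  \<open>exp 1\<close> offsets the constant of \<open>run_prob_lower\<close>, so that the total is
  at least 1 once balance fails.\<close>

definition run_total :: "'a set \<Rightarrow> real" where
  "run_total A = exp 1 * (\<Sum>u\<in>V. \<Sum>v\<in>V. run_prob K (N u - N v) (N v - N u) A)"

text \<open>Bounds the conditional probability of failure: it is at least 1 after a deviation beyond
  \<open>eps * mu\<close> or a loss of balance, and does not grow on average before that. The two
  exponents treat the two tails, and the prefactor normalises the value at a deviation of
  \<open>eps * mu\<close>.\<close>

definition deviation_bound :: "nat \<Rightarrow> 'a set \<Rightarrow> 'a set \<Rightarrow> real \<Rightarrow> real" where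
  "deviation_bound k A P c = exp (th * mu - (lam - th) * (eps * mu)) * (exp_potential lam k A P c + exp_potential (- lam) k A P c) + run_total A"

lemma run_prob_nonneg: "0 \<le> run_prob K X Y A"
  by (simp add: run_prob_def)

lemma run_total_nonneg: "0 \<le> run_total A"
  unfolding run_total_def by (intro mult_nonneg_nonneg sum_nonneg run_prob_nonneg) auto

lemma exp_potential_nonneg: "0 \<le> exp_potential r k A P c"
  by (simp add: exp_potential_def)

lemma deviation_bound_nonneg: "0 \<le> deviation_bound k A P c"
  unfolding deviation_bound_def exp_potential_def using run_total_nonneg by (intro add_nonneg_nonneg) auto

lemma run_total_step:
  assumes "A \<subseteq> V"
  shows "(\<Sum>u\<in>A. run_total (A - {u})) \<le> real (card A) * run_total A"
proof -
  have fA: "finite A" using assms finite_V finite_subset by blast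
  have "(\<Sum>w\<in>A. run_total (A - {w})) = exp 1 * (\<Sum>u\<in>V. \<Sum>v\<in>V. \<Sum>w\<in>A. run_prob K (N u - N v) (N v - N u) (A - {w}))"
    unfolding run_total_def sum_distrib_left[symmetric]
    by (subst sum.swap) (intro arg_cong2[where f = "(*)"] refl sum.cong sum.swap)
  also have "\<dots> \<le> exp 1 * (\<Sum>u\<in>V. \<Sum>v\<in>V. real (card A) * run_prob K (N u - N v) (N v - N u) A)"
    by (intro mult_left_mono sum_mono run_prob_supermartingale fA) auto
  also have "\<dots> = real (card A) * run_total A"
    by (simp add: run_total_def sum_distrib_left mult_ac)
  finally show ?thesis .
qed

lemma run_total_ge_1:
  assumes "A \<subseteq> V" "\<not> balanced K A"
  shows "1 \<le> run_total A"
proof -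
  have fA: "finite A" using assms finite_V finite_subset by blast
  obtain u v where uv: "u \<in> V" "v \<in> V" and big: "card (N u \<inter> A) > K * (card (N v \<inter> A) + 1)"
    using assms unfolding balanced_def by (auto simp: not_le)
  \<comment> \<open>Common open neighbours occur on both sides of \<open>big\<close>. As
    \<open>K \<ge> 1\<close>, cancelling them leaves the inequality for the two halves of the
    symmetric difference.\<close>
  define z where "z = card (N u \<inter> N v \<inter> A)"
  have split: "card (N a \<inter> A) = card ((N a - N b) \<inter> A) + card (N a \<inter> N b \<inter> A)" for a b
  proof -
    have "N a \<inter> A = (N a - N b) \<inter> A \<union> N a \<inter> N b \<inter> A" by auto
    moreover have "card ((N a - N b) \<inter> A \<union> N a \<inter> N b \<inter> A) = card ((N a - N b) \<inter> A) + card (N a \<inter> N b \<inter> A)"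
      using fA by (intro card_Un_disjoint) auto
    ultimately show ?thesis by simp
  qed
  have "K * (card ((N v - N u) \<inter> A) + 1) + K * z < card ((N u - N v) \<inter> A) + z"
    using big unfolding split[of u v] split[of v u] z_def by (simp add: Int_commute algebra_simps)
  moreover have "z \<le> K * z" using K by simp
  ultimately have "K * (card ((N v - N u) \<inter> A) + 1) < card ((N u - N v) \<inter> A)" by linarith
  then have "1 \<le> exp 1 * run_prob K (N u - N v) (N v - N u) A"
    by (intro run_prob_lower fA K) auto
  also have "\<dots> \<le> run_total A"
  proof -
    have "run_prob K (N u - N v) (N v - N u) A \<le> (\<Sum>v\<in>V. run_prob K (N u - N v) (N v - N u) A)"
      using finite_V uv run_prob_nonneg by (intro member_le_sum[where f = "\<lambda>v. run_prob K (N u - N v) (N v - N u) A"]) auto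
    also have "\<dots> \<le> (\<Sum>u\<in>V. \<Sum>v\<in>V. run_prob K (N u - N v) (N v - N u) A)"
      using finite_V uv run_prob_nonneg
      by (intro member_le_sum[where f = "\<lambda>u. \<Sum>v\<in>V. run_prob K (N u - N v) (N v - N u) A"]) (auto intro!: sum_nonneg)
    finally show ?thesis unfolding run_total_def by (intro mult_left_mono) auto
  qed
  finally show ?thesis .
qed

text \<open>With \<open>D = c + potential k A P\<close> the penalty is at most
  \<open>th * D\<close>. In the upper tail this lowers the rate from \<open>lam\<close> to
  \<open>lam - th\<close>; in the lower tail it is at most \<open>th * mu\<close>, which the
  prefactor repays. The harmonic term only helps.\<close>

lemma deviation_bound_ge_1:
  assumes "c \<ge> 0" "\<bar>c + potential k A P - mu\<bar> > eps * mu"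
  shows "1 \<le> deviation_bound k A P c"
proof -
  define D where "D = c + potential k A P"
  have cD: "c \<le> D" using potential_nonneg by (simp add: D_def)
  have th0: "0 \<le> th" using th J by simp
  have J0: "J \<ge> 0" using J by simp
  have hr: "0 \<le> 8 * lam\<^sup>2 * J * mu * harm (card A)" using J0 mu by (simp add: harm_nonneg)
  have c: "th * c \<le> th * D" using cD th0 by (intro mult_left_mono)
  have "1 \<le> exp (th * mu - (lam - th) * (eps * mu)) * (exp_potential lam k A P c + exp_potential (- lam) k A P c)"
  proof (cases "D \<ge> mu")
    case True
    then have "D - mu \<ge> eps * mu" using assms by (simp add: D_def)
    then have "(lam - th) * (eps * mu) \<le> (lam - th) * (D - mu)" using th by (intro mult_left_mono) auto
    then have "0 \<le> th * mu - (lam - th) * (eps * mu) + (lam * (D - mu) - th * c + 8 * lam\<^sup>2 * J * mu * harm (card A))"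
      using c hr by (simp add: algebra_simps)
    then have "1 \<le> exp (th * mu - (lam - th) * (eps * mu)) * exp_potential lam k A P c"
      unfolding exp_potential_def D_def[symmetric] by (simp flip: exp_add)
    then show ?thesis by (simp add: distrib_left exp_potential_def add_increasing2)
  next
    case False
    then have "mu - D \<ge> eps * mu" using assms by (simp add: D_def)
    then have "lam * (eps * mu) \<le> lam * (mu - D)" using th(3) th0 by (intro mult_left_mono) linarith+
    moreover have "th * c \<le> th * mu" using c False th0 mult_left_mono[of D mu th] by linarith
    moreover have "0 \<le> th * (eps * mu)" using th0 eps mu by simp
    ultimately have "0 \<le> th * mu - (lam - th) * (eps * mu) + (- lam * (D - mu) - th * c + 8 * lam\<^sup>2 * J * mu * harm (card A))"
      using hr by (simp add: algebra_simps)
    then have "1 \<le> exp (th * mu - (lam - th) * (eps * mu)) * exp_potential (- lam) k A P c"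
      unfolding exp_potential_def D_def[symmetric] by (simp flip: exp_add)
    then show ?thesis by (simp add: distrib_left exp_potential_def add_increasing)
  qed
  then show ?thesis unfolding deviation_bound_def using run_total_nonneg[of A] by linarith
qed

text \<open>The factor by which \<open>step_mgf\<close> may exceed 1 is exactly cancelled by the
  drop \<open>1 / card A\<close> of the harmonic number.\<close>

lemma exp_potential_step:
  assumes AV: "A \<subseteq> V" and PA: "P \<inter> A = {}" and finP: "finite P" and ne: "A \<noteq> {}"
    and bal: "balanced K A" and potle: "potential k A P \<le> 2 * mu" and r: "r = lam \<or> r = - lam"
  shows "(\<Sum>u\<in>A. exp_potential r k (A - {u}) (insert u P) (c + of_bool (settles k A P True u)) +
         exp_potential r k (A - {u}) P (c + of_bool (settles k A P False u))) \<le> 2 * real (card A) * exp_potential r k A P c"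
proof -
  have fA: "finite A" using AV finite_V finite_subset by blast
  have m: "card A > 0" using ne fA by (simp add: card_gt_0_iff)
  let ?q = "8 * lam\<^sup>2 * J * mu / real (card A)"
  have psi_eq: "exp_potential r k (A - {u}) (if s then insert u P else P) (c + of_bool (settles k A P s u)) =
     exp_potential r k A P c * exp (- ?q) * exp (r * increment k A P s u - th * of_bool (settles k A P s u))" if "u \<in> A" for u s
  proof -
    have "harm (card A) = (harm (card (A - {u})) :: real) + 1 / real (card A)"
      using m that fA harm_Suc[of "card A - 1", where 'a=real] by (simp add: divide_inverse)
    then have "8 * lam\<^sup>2 * J * mu * harm (card A) = 8 * lam\<^sup>2 * J * mu * harm (card (A - {u})) + ?q"
      by (simp add: distrib_left)
    then show ?thesis unfolding exp_potential_def increment_def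
      by (simp add: algebra_simps flip: exp_add del: of_bool_eq_iff)
  qed
  have rl: "r\<^sup>2 = lam\<^sup>2" using r by auto
  have lam0: "lam \<ge> 0" using th J by (metis order_trans mult_nonneg_nonneg zero_le_power2 of_nat_0_le_iff add_nonneg_nonneg zero_le_one zero_le_numeral)
  have "(\<Sum>u\<in>A. exp_potential r k (A - {u}) (insert u P) (c + of_bool (settles k A P True u)) +
         exp_potential r k (A - {u}) P (c + of_bool (settles k A P False u))) =
     exp_potential r k A P c * exp (- ?q) * (\<Sum>u\<in>A. exp (r * increment k A P True u - th * of_bool (settles k A P True u)) +
        exp (r * increment k A P False u - th * of_bool (settles k A P False u)))"
    unfolding sum_distrib_left
    by (intro sum.cong refl) (use psi_eq[where s=True] psi_eq[where s=False] in \<open>simp add: distrib_left\<close>)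
  also have "\<dots> \<le> exp_potential r k A P c * exp (- ?q) * (2 * real (card A) * exp (8 * r\<^sup>2 * J * mu / real (card A)))"
  proof (intro mult_left_mono)
    show "0 \<le> exp_potential r k A P c * exp (- ?q)" using exp_potential_nonneg by simp
    have "\<bar>r\<bar> * J \<le> 1/2" using r lam lam0 by auto
    then show "(\<Sum>u\<in>A. exp (r * increment k A P True u - th * of_bool (settles k A P True u)) +
        exp (r * increment k A P False u - th * of_bool (settles k A P False u)))
      \<le> 2 * real (card A) * exp (8 * r\<^sup>2 * J * mu / real (card A))"
      using th(1) unfolding rl[symmetric] by (intro step_mgf[OF AV PA finP bal J _ th(2) _ potle ne])
  qed
  also have "\<dots> = 2 * real (card A) * exp_potential r k A P c"
    unfolding rl by (simp flip: exp_add)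
  finally show ?thesis .
qed

lemma deviation_bound_step:
  assumes AV: "A \<subseteq> V" and PA: "P \<inter> A = {}" and finP: "finite P" and ne: "A \<noteq> {}"
    and bal: "balanced K A" and potle: "potential k A P \<le> 2 * mu"
  shows "(\<Sum>u\<in>A. deviation_bound k (A - {u}) (insert u P) (c + of_bool (settles k A P True u)) +
         deviation_bound k (A - {u}) P (c + of_bool (settles k A P False u))) \<le> 2 * real (card A) * deviation_bound k A P c"
proof -
  let ?e = "exp (th * mu - (lam - th) * (eps * mu))"
  let ?S = "\<lambda>r. (\<Sum>u\<in>A. exp_potential r k (A - {u}) (insert u P) (c + of_bool (settles k A P True u)) +
         exp_potential r k (A - {u}) P (c + of_bool (settles k A P False u)))"
  have "(\<Sum>u\<in>A. deviation_bound k (A - {u}) (insert u P) (c + of_bool (settles k A P True u)) +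
         deviation_bound k (A - {u}) P (c + of_bool (settles k A P False u))) =
     ?e * (?S lam + ?S (- lam)) + 2 * (\<Sum>u\<in>A. run_total (A - {u}))"
    unfolding deviation_bound_def by (simp add: sum.distrib sum_distrib_left distrib_left)
  also have "\<dots> \<le> ?e * (2 * real (card A) * exp_potential lam k A P c + 2 * real (card A) * exp_potential (- lam) k A P c) +
      2 * (real (card A) * run_total A)"
    by (intro add_mono mult_left_mono exp_potential_step[OF assms] run_total_step AV) auto
  also have "\<dots> = 2 * real (card A) * deviation_bound k A P c"
    by (simp add: deviation_bound_def algebra_simps)
  finally show ?thesis .
qed

text \<open>Induction on the number of vertices to come, that is, optional stopping at the first
  imbalance or deviation.\<close>

lemma average_le_deviation_bound:
  assumes "finite A" "A \<subseteq> V" "P \<inter> A = {}" "finite P" "c \<ge> 0"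
  shows "(\<Sum>l\<in>permutations_of_set A. \<Sum>Q\<in>Pow A. of_bool (\<bar>c + real (count_degree N k Q P l) - mu\<bar> > eps * mu))
    \<le> fact (card A) * 2 ^ card A * deviation_bound k A P c"
  using assms
proof (induction "card A" arbitrary: A P c)
  case 0
  then have A: "A = {}" by auto
  show ?case
  proof (cases "\<bar>c - mu\<bar> > eps * mu")
    case True
    then have "1 \<le> deviation_bound k {} P c" using 0 by (intro deviation_bound_ge_1) (auto simp: potential_def)
    then show ?thesis using True by (simp add: A)
  qed (use deviation_bound_nonneg in \<open>simp add: A\<close>)
next
  case (Suc m)
  note fA = \<open>finite A\<close>
  have ne: "A \<noteq> {}" using Suc.hyps(2) by auto
  let ?b = "\<lambda>c P l Q. of_bool (\<bar>c + real (count_degree N k Q P l) - mu\<bar> > eps * mu) :: real"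
  show ?case
  proof (cases "balanced K A \<and> \<bar>c + potential k A P - mu\<bar> \<le> eps * mu")
    \<comment> \<open>The process has stopped: the bound is at least 1, so the trivial estimate by
      the number of pairs suffices.\<close>
    case False
    then have "1 \<le> deviation_bound k A P c"
    proof (cases "balanced K A")
      case True
      then show ?thesis using False Suc.prems by (intro deviation_bound_ge_1) auto
    next
      case False
      then have "1 \<le> run_total A" using Suc.prems by (intro run_total_ge_1)
      then show ?thesis unfolding deviation_bound_def exp_potential_def by (intro add_increasing) auto
    qed
    have "(\<Sum>l\<in>permutations_of_set A. \<Sum>Q\<in>Pow A. ?b c P l Q) \<le> (\<Sum>l\<in>permutations_of_set A. \<Sum>Q\<in>Pow A. 1)"
      by (intro sum_mono) simp
    also have "\<dots> = fact (card A) * 2 ^ card A * 1" using fA by (simp add: card_Pow)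
    also have "\<dots> \<le> fact (card A) * 2 ^ card A * deviation_bound k A P c"
      using \<open>1 \<le> deviation_bound k A P c\<close> by (intro mult_left_mono) auto
    finally show ?thesis .
  next
    case True
    \<comment> \<open>Without a deviation so far and with \<open>c \<ge> 0\<close>, the potential is
      at most \<open>(1 + eps) * mu\<close>, as the one-step bound requires.\<close>
    have "potential k A P \<le> (1 + eps) * mu" using True Suc.prems by (auto simp: distrib_right abs_le_iff)
    also have "\<dots> \<le> 2 * mu" using eps mu by (intro mult_right_mono) auto
    finally have potle: "potential k A P \<le> 2 * mu" .
    let ?s = "\<lambda>s u. of_bool (settles k A P s u) :: real"
    have IH: "(\<Sum>l\<in>permutations_of_set (A - {u}). \<Sum>Q\<in>Pow (A - {u}). ?b c' P' l Q) \<le>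
        fact m * 2 ^ m * deviation_bound k (A - {u}) P' c'" 
      if "u \<in> A" "P' = P \<or> P' = insert u P" "c' \<ge> 0" for u P' c'
    proof -
      have "card (A - {u}) = m" using Suc.hyps(2) that fA by simp
      then show ?thesis using Suc.hyps(1)[of "A - {u}" P' c'] that Suc.prems by auto
    qed
    have "(\<Sum>l\<in>permutations_of_set A. \<Sum>Q\<in>Pow A. ?b c P l Q) = 
      (\<Sum>u\<in>A. \<Sum>l\<in>permutations_of_set (A - {u}). \<Sum>Q\<in>Pow (A - {u}).
         ?b c P (u # l) (insert u Q) + ?b c P (u # l) Q)"
      by (rule sum_permutations_Pow[OF fA ne])
    also have "\<dots> = (\<Sum>u\<in>A. \<Sum>l\<in>permutations_of_set (A - {u}). \<Sum>Q\<in>Pow (A - {u}).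
         ?b (c + ?s True u) (insert u P) l Q + ?b (c + ?s False u) P l Q)"
    proof (intro sum.cong refl)
      fix u l Q assume u: "u \<in> A" and l: "l \<in> permutations_of_set (A - {u})" and Q: "Q \<in> Pow (A - {u})"
      have sl: "set l = A - {u}" using l by (simp add: permutations_of_set_def)
      \<comment> \<open>\<open>settles\<close> counts neighbours in \<open>A\<close>,
        \<open>count_degree\<close> those in the rest of the list; they agree because
        \<open>u\<close> is not its own neighbour.\<close>
      have "N u \<inter> (A - {u}) = N u \<inter> A" using N_irrefl by auto
      moreover have "count_degree N k (insert u Q) (insert u P) l = count_degree N k Q (insert u P) l"
        by (intro count_degree_cong) (use sl in auto)
      ultimately have "real (count_degree N k (insert u Q) P (u # l)) = ?s True u + real (count_degree N k Q (insert u P) l)"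
        "real (count_degree N k Q P (u # l)) = ?s False u + real (count_degree N k Q P l)"
        using Q by (auto simp: settles_def sl)
      then show "?b c P (u # l) (insert u Q) + ?b c P (u # l) Q =
         ?b (c + ?s True u) (insert u P) l Q + ?b (c + ?s False u) P l Q"
        by (simp only: add.assoc)
    qed
    also have "\<dots> \<le> (\<Sum>u\<in>A. fact m * 2 ^ m * deviation_bound k (A - {u}) (insert u P) (c + ?s True u) +
         fact m * 2 ^ m * deviation_bound k (A - {u}) P (c + ?s False u))"
      unfolding sum.distrib using Suc.prems by (intro add_mono sum_mono IH) auto
    also have "\<dots> = fact m * 2 ^ m * (\<Sum>u\<in>A. deviation_bound k (A - {u}) (insert u P) (c + ?s True u) +
         deviation_bound k (A - {u}) P (c + ?s False u))"
      by (simp add: sum_distrib_left distrib_left)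
    also have "\<dots> \<le> fact m * 2 ^ m * (2 * real (card A) * deviation_bound k A P c)"
      using Suc.prems True potle ne by (intro mult_left_mono deviation_bound_step) auto
    also have "\<dots> = fact (card A) * 2 ^ card A * deviation_bound k A P c"
      unfolding Suc.hyps(2)[symmetric] by (simp add: algebra_simps)
    finally show ?thesis .
  qed
qed

text \<open>At the start all degrees \<open>0..d\<close> are equally likely for every vertex, so the
  potential is exactly \<open>mu\<close>. What remains is the harmonic cost, where
  \<open>8 * lam\<^sup>2 * J = th\<close>, and the \<open>2 ^ K\<close> decay for each pair.\<close>

lemma deviation_bound_initial:
  assumes mu_eq: "mu = real (card V) / real (d + 1)" and k: "k \<le> d" and ne: "V \<noteq> {}"
  shows "deviation_bound k V {} 0 \<le>
    2 * exp (th * mu - (lam - th) * (eps * mu) + th * mu * (ln (real (card V)) + 1)) +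
    exp 1 * (real (card V))\<^sup>2 * (1/2) ^ K"
proof -
  have n: "card V > 0" using ne finite_V by (simp add: card_gt_0_iff)
  have "potential k V {} = (\<Sum>v\<in>V. 1 / real (d + 1))"
    unfolding potential_def
  proof (intro sum.cong refl)
    fix v assume v: "v \<in> V"
    then have "N v \<inter> V = N v" using N_subset by auto
    then show "hit_prob k (card (N v \<inter> {})) (card (N v \<inter> V)) = 1 / real (d + 1)"
      using k v by (simp add: hit_prob_def card_N add.commute)
  qed
  then have "potential k V {} = mu" by (simp add: mu_eq)
  moreover have "8 * lam\<^sup>2 * J * mu * harm (card V) \<le> th * mu * (ln (real (card V)) + 1)"
    unfolding th(1) using harm_le[OF n] mu J by (intro mult_left_mono) auto
  ultimately have exp_potential: "exp_potential r k V {} 0 \<le> exp (th * mu * (ln (real (card V)) + 1))" for r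
    by (simp add: exp_potential_def)
  have "run_total V \<le> exp 1 * (\<Sum>u\<in>V. \<Sum>v\<in>V. (1/2) ^ K)"
    unfolding run_total_def
  proof (intro mult_left_mono sum_mono)
    fix u v assume uv: "u \<in> V" "v \<in> V"
    have f: "finite (N w)" if "w \<in> V" for w using N_subset[OF that] finite_V finite_subset by blast
    \<comment> \<open>Regularity makes the two differences equally large, as
      \<open>run_prob_initial\<close> requires.\<close>
    have "card (N u - N v) = card (N v - N u)"
      using card_N[OF uv(1)] card_N[OF uv(2)] f[OF uv(1)] f[OF uv(2)]
      by (simp add: card_Diff_subset_Int Int_commute)
    then show "run_prob K (N u - N v) (N v - N u) V \<le> (1/2) ^ K"
      using f uv N_subset by (intro run_prob_initial) auto
  qed auto
  then have run: "run_total V \<le> exp 1 * (real (card V))\<^sup>2 * (1/2) ^ K"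
    by (simp add: power2_eq_square)
  let ?e = "exp (th * mu - (lam - th) * (eps * mu))"
  have "?e * (exp_potential lam k V {} 0 + exp_potential (- lam) k V {} 0) \<le> ?e * (2 * exp (th * mu * (ln (real (card V)) + 1)))"
    using exp_potential[of lam] exp_potential[of "- lam"] by (intro mult_left_mono) auto
  also have "\<dots> = 2 * exp (th * mu - (lam - th) * (eps * mu) + th * mu * (ln (real (card V)) + 1))"
    by (simp add: exp_add)
  finally show ?thesis using run unfolding deviation_bound_def by linarith
qed

end

section \<open>Orders and signs of uniform weights\<close>

definition std_uniform :: "real measure" where "std_uniform = uniform_measure lborel {0..1}"

lemma sets_std_uniform [simp, measurable_cong]: "sets std_uniform = sets borel"
  and space_std_uniform [simp]: "space std_uniform = UNIV"
  by (simp_all add: std_uniform_def)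

lemma prob_space_std_uniform: "prob_space std_uniform"
  unfolding std_uniform_def by (rule prob_space_uniform_measure) auto

lemma product_prob_space_std_uniform: "product_prob_space (\<lambda>_. std_uniform)"
  by (intro product_prob_spaceI prob_space_std_uniform)

lemma vertex_weights_eq: "vertex_weights V = PiM V (\<lambda>_. std_uniform)"
  by (simp add: vertex_weights_def std_uniform_def)

lemma emeasure_std_uniform: "A \<in> sets borel \<Longrightarrow> emeasure std_uniform A = emeasure lborel ({0..1} \<inter> A)"
  unfolding std_uniform_def by (subst emeasure_uniform_measure) (auto simp: divide_ennreal_def)

lemma emeasure_std_uniform_reflect:
  assumes A: "A \<in> sets borel"
  shows "emeasure std_uniform ((\<lambda>t. 1 - t) -` A) = emeasure std_uniform A"
proof -
  have m: "(\<lambda>t::real. 1 - t) -` B \<in> sets borel" if "B \<in> sets borel" for B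
    using measurable_sets[of "\<lambda>t::real. 1 - t" borel borel B] that by auto
  have l: "lborel = distr lborel borel (\<lambda>t::real. 1 - t)"
    using lborel_real_affine[of "-1" 1] by (simp add: density_1)
  have "emeasure lborel ({0..1} \<inter> A) = emeasure lborel ((\<lambda>t. 1 - t) -` ({0..1} \<inter> A))"
    using A by (subst l, subst emeasure_distr) auto
  also have "(\<lambda>t. 1 - t) -` ({0..1} \<inter> A) = {0..1::real} \<inter> (\<lambda>t. 1 - t) -` A" by auto
  finally show ?thesis using A m by (simp add: emeasure_std_uniform)
qed

lemma emeasure_std_uniform_singleton: "emeasure std_uniform {t} = 0"
  by (subst emeasure_std_uniform) (auto intro!: emeasure_eq_0[OF _ emeasure_lborel_singleton[of t]])

text \<open>Equals \<open>1/2 - \<bar>t - 1/2\<bar>\<close>, hence is invariant under the reflection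
  of \<open>t\<close> to \<open>1 - t\<close>, which swaps the signs.\<close>

definition half_dist :: "real \<Rightarrow> real" where "half_dist t = min t (1 - t)"

text \<open>Permutes the coordinates and reflects those in \<open>F\<close> about \<open>1 / 2\<close>. Such maps preserve the product
  measure and act transitively on the patterns below, so all patterns are equally likely.\<close>

definition sym_map :: "'a set \<Rightarrow> ('a \<Rightarrow> 'a) \<Rightarrow> 'a set \<Rightarrow> ('a \<Rightarrow> real) \<Rightarrow> 'a \<Rightarrow> real" where
  "sym_map V \<sigma> F x = (\<lambda>v\<in>V. if v \<in> F then 1 - x (\<sigma> v) else x (\<sigma> v))"

context
  fixes V :: "'a set"
  assumes finV: "finite V"
begin

interpretation product_prob_space "\<lambda>_. std_uniform" V by (rule product_prob_space_std_uniform)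

abbreviation "unif_weights \<equiv> PiM V (\<lambda>_. std_uniform)"

lemma distr_flip: "distr unif_weights unif_weights (\<lambda>x. \<lambda>v\<in>V. if v \<in> F then 1 - x v else x v) = unif_weights"
proof (rule PiM_eqI[OF finV])
  let ?T = "\<lambda>x. \<lambda>v\<in>V. if v \<in> F then 1 - x v else x v :: real"
  let ?g = "\<lambda>v t. if v \<in> F then 1 - t else t :: real"
  have T: "?T \<in> measurable unif_weights unif_weights" by measurable
  fix A assume A: "\<And>i. i \<in> V \<Longrightarrow> A i \<in> sets std_uniform"
  have gA: "?g v -` A v \<in> sets std_uniform" if "v \<in> V" for v
    using measurable_sets[of "?g v" borel borel "A v"] A[OF that] by auto
  have "?T -` Pi\<^sub>E V A \<inter> space unif_weights = (\<Pi>\<^sub>E v\<in>V. ?g v -` A v)"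
    by (auto simp: space_PiM PiE_iff extensional_def)
  then have "emeasure (distr unif_weights unif_weights ?T) (Pi\<^sub>E V A) = emeasure unif_weights (\<Pi>\<^sub>E v\<in>V. ?g v -` A v)"
    using A finV by (subst emeasure_distr[OF T]) (auto intro!: sets_PiM_I_finite)
  also have "\<dots> = (\<Prod>v\<in>V. emeasure std_uniform (?g v -` A v))"
    using gA finV by (intro emeasure_PiM) auto
  also have "\<dots> = (\<Prod>v\<in>V. emeasure std_uniform (A v))"
  proof (intro prod.cong refl)
    fix v assume "v \<in> V"
    then show "emeasure std_uniform (?g v -` A v) = emeasure std_uniform (A v)"
      using A[of v] by (cases "v \<in> F") (use emeasure_std_uniform_reflect[of "A v"] in \<open>simp_all add: vimage_def\<close>)
  qed
  finally show "emeasure (distr unif_weights unif_weights ?T) (Pi\<^sub>E V A) = (\<Prod>v\<in>V. emeasure std_uniform (A v))" .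
qed simp

lemma sym_map_measurable:
  assumes "\<sigma> \<in> V \<rightarrow> V"
  shows "sym_map V \<sigma> F \<in> measurable unif_weights unif_weights"
proof -
  have m: "(\<lambda>x. x (\<sigma> v)) \<in> borel_measurable unif_weights" if "v \<in> V" for v
    using assms that measurable_component_singleton[of "\<sigma> v" V "\<lambda>_. std_uniform"] by (auto simp: Pi_iff)
  show ?thesis unfolding sym_map_def
  proof (rule measurable_restrict)
    fix v assume "v \<in> V"
    then show "(\<lambda>x. if v \<in> F then 1 - x (\<sigma> v) else x (\<sigma> v)) \<in> measurable unif_weights std_uniform"
      using m[of v] by (cases "v \<in> F") (simp_all cong: measurable_cong_sets)
  qed
qed

lemma distr_sym_map:
  assumes "bij_betw \<sigma> V V"
  shows "distr unif_weights unif_weights (sym_map V \<sigma> F) = unif_weights"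
proof -
  have s: "inj_on \<sigma> V" "\<sigma> \<in> V \<rightarrow> V" using assms by (auto simp: bij_betw_def)
  let ?R = "\<lambda>x. \<lambda>v\<in>V. x (\<sigma> v) :: real"
  let ?T = "\<lambda>x. \<lambda>v\<in>V. if v \<in> F then 1 - x v else x v :: real"
  have R: "?R \<in> measurable unif_weights unif_weights" using sym_map_measurable[OF s(2), of "{}"] by (simp add: sym_map_def[abs_def])
  have T: "?T \<in> measurable unif_weights unif_weights" by measurable
  have "sym_map V \<sigma> F = ?T \<circ> ?R" by (auto simp: sym_map_def fun_eq_iff)
  then have "distr unif_weights unif_weights (sym_map V \<sigma> F) = distr (distr unif_weights unif_weights ?R) unif_weights ?T"
    by (simp only: distr_distr[OF T R])
  also have "distr unif_weights unif_weights ?R = unif_weights" using distr_reorder[OF s finV] by simp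
  also have "distr unif_weights unif_weights ?T = unif_weights" by (rule distr_flip)
  finally show ?thesis .
qed

text \<open>By Fubini: with the other coordinates fixed, \<open>x u\<close> would have to hit a
  single point.\<close>

lemma AE_not_on_graph:
  assumes uv: "u \<in> V" "v \<in> V" "u \<noteq> v" and g[measurable]: "g \<in> borel_measurable borel"
  shows "AE x in unif_weights. x u \<noteq> g (x v)"
proof -
  define I where "I = V - {u}"
  have V: "V = insert u I" and uI: "u \<notin> I" "finite I" "v \<in> I" using uv finV by (auto simp: I_def)
  let ?N = "{x \<in> space unif_weights. x u = g (x v)}"
  have N: "?N \<in> sets unif_weights"
  proof -
    have [measurable]: "(\<lambda>x. x u) \<in> borel_measurable unif_weights" "(\<lambda>x. x v) \<in> borel_measurable unif_weights"
      using uv measurable_component_singleton[of _ V "\<lambda>_. std_uniform"] by auto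
    show ?thesis by measurable
  qed
  have "emeasure unif_weights ?N = (\<integral>\<^sup>+ x. indicator ?N x \<partial>PiM (insert u I) (\<lambda>_. std_uniform))"
    using N V by simp
  also have "\<dots> = (\<integral>\<^sup>+ x. (\<integral>\<^sup>+ y. indicator ?N (x(u := y)) \<partial>std_uniform) \<partial>PiM I (\<lambda>_. std_uniform))"
    using N V uI by (intro product_nn_integral_insert) auto
  also have "\<dots> = (\<integral>\<^sup>+ x. 0 \<partial>PiM I (\<lambda>_. std_uniform))"
  proof (intro nn_integral_cong)
    fix x assume "x \<in> space (PiM I (\<lambda>_. std_uniform))"
    have "(\<integral>\<^sup>+ y. indicator ?N (x(u := y)) \<partial>std_uniform) \<le> (\<integral>\<^sup>+ y. indicator {g (x v)} y \<partial>std_uniform)"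
      using uv by (intro nn_integral_mono) (auto simp: indicator_def)
    also have "\<dots> = 0" by (simp add: emeasure_std_uniform_singleton)
    finally show "(\<integral>\<^sup>+ y. indicator ?N (x(u := y)) \<partial>std_uniform) = 0" by simp
  qed
  finally have "emeasure unif_weights ?N = 0" by simp
  then show ?thesis using N by (intro AE_I[of _ _ ?N]) auto
qed

lemma AE_not_half:
  assumes "v \<in> V"
  shows "AE x in unif_weights. x v \<noteq> 1/2"
proof -
  have "AE t in std_uniform. t \<noteq> 1/2"
    by (rule AE_I[of _ _ "{1/2}"]) (auto simp: emeasure_std_uniform_singleton)
  then show ?thesis using AE_PiM_component[of V "\<lambda>_. std_uniform" v "\<lambda>t. t \<noteq> 1/2"] prob_space_std_uniform assms by simp
qed

section \<open>Generic weights and equally likely patterns\<close>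

definition generic :: "('a \<Rightarrow> real) \<Rightarrow> bool" where
  "generic x \<longleftrightarrow> inj_on (\<lambda>v. half_dist (x v)) V \<and> (\<forall>v\<in>V. x v \<noteq> 1/2)"

lemma AE_generic: "AE x in unif_weights. generic x"
proof -
  \<comment> \<open>A tie in \<open>half_dist\<close> means \<open>x u = x v\<close> or
    \<open>x u = 1 - x v\<close>, so two curves are excluded.\<close>
  have "AE x in unif_weights. \<forall>u\<in>V. \<forall>v\<in>V. u \<noteq> v \<longrightarrow> x u \<noteq> x v"
    using AE_not_on_graph[of _ _ "\<lambda>t. t"] finV by (intro AE_finite_allI) (auto intro!: AE_impI)
  moreover have "AE x in unif_weights. \<forall>u\<in>V. \<forall>v\<in>V. u \<noteq> v \<longrightarrow> x u \<noteq> 1 - x v"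
    using AE_not_on_graph[of _ _ "\<lambda>t. 1 - t"] finV by (intro AE_finite_allI) (auto intro!: AE_impI)
  moreover have "AE x in unif_weights. \<forall>v\<in>V. x v \<noteq> 1/2"
    using AE_not_half finV by (intro AE_finite_allI) auto
  ultimately show ?thesis
  proof eventually_elim
    case (elim x)
    have "u = v" if "u \<in> V" "v \<in> V" "half_dist (x u) = half_dist (x v)" for u v
    proof (rule ccontr)
      assume "u \<noteq> v"
      then have "x u \<noteq> x v" "x u \<noteq> 1 - x v" using elim that by auto
      with that(3) show False by (auto simp: half_dist_def min_def split: if_splits)
    qed
    then show ?case using elim by (auto simp: generic_def inj_on_def)
  qed
qed

text \<open>Strict inequalities make distinct patterns disjoint; what they leave uncovered is not
  generic.\<close>

definition pattern :: "'a list \<Rightarrow> 'a set \<Rightarrow> ('a \<Rightarrow> real) \<Rightarrow> bool" where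
  "pattern l Q x \<longleftrightarrow> sorted_wrt (\<lambda>u v. half_dist (x u) < half_dist (x v)) l \<and>
     (\<forall>v\<in>V. if v \<in> Q then x v > 1/2 else x v < 1/2)"

lemma pattern_sets [measurable]:
  assumes "set l \<subseteq> V"
  shows "{x \<in> space unif_weights. pattern l Q x} \<in> sets unif_weights"
proof -
  have [measurable]: "(\<lambda>x. x v) \<in> borel_measurable unif_weights" if "v \<in> V" for v
    using that measurable_component_singleton[of v V "\<lambda>_. std_uniform"] by auto
  have [measurable]: "(\<lambda>x. half_dist (x v)) \<in> borel_measurable unif_weights" if "v \<in> V" for v
    unfolding half_dist_def using that by measurable
  have 1: "{x \<in> space unif_weights. half_dist (x u) < half_dist (x v)} \<in> sets unif_weights" if "u \<in> V" "v \<in> V" for u v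
    using that by measurable
  have 2: "{x \<in> space unif_weights. if v \<in> Q then x v > 1/2 else x v < 1/2} \<in> sets unif_weights" if "v \<in> V" for v
    using that by measurable
  have 3: "{x \<in> space unif_weights. \<forall>v\<in>V. if v \<in> Q then x v > 1/2 else x v < 1/2} \<in> sets unif_weights"
    using 2 finV by (intro sets.sets_Collect_finite_All) auto
  have 4: "{x \<in> space unif_weights. \<forall>i\<in>{..<length l}. \<forall>j\<in>{..<length l}. i < j \<longrightarrow> half_dist (x (l ! i)) < half_dist (x (l ! j))} \<in> sets unif_weights"
    using 1 assms nth_mem by (intro sets.sets_Collect_finite_All sets.sets_Collect_imp) (auto simp: subset_iff)
  \<comment> \<open>Finite conjunctions of comparisons are visibly measurable.\<close>
  have "pattern l Q x \<longleftrightarrow>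
      (\<forall>i\<in>{..<length l}. \<forall>j\<in>{..<length l}. i < j \<longrightarrow> half_dist (x (l ! i)) < half_dist (x (l ! j))) \<and>
      (\<forall>v\<in>V. if v \<in> Q then x v > 1/2 else x v < 1/2)" for x
    unfolding pattern_def sorted_wrt_iff_nth_less
    by (intro conj_cong refl) (meson lessThan_iff order.strict_trans)
  then show ?thesis using sets.sets_Collect_conj[OF 3 4] by (simp only:)
qed

lemma ex_bij_map:
  assumes "l \<in> permutations_of_set V" "l' \<in> permutations_of_set V"
  shows "\<exists>\<sigma>. bij_betw \<sigma> V V \<and> map \<sigma> l = l'"
proof -
  have l: "set l = V" "distinct l" "set l' = V" "distinct l'" using assms by (auto simp: permutations_of_set_def)
  then have len: "length l = length l'" by (metis distinct_card)
  have b: "bij_betw ((!) l) {..<length l} V" "bij_betw ((!) l') {..<length l} V"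
    using l len by (auto intro!: bij_betw_nth)
  let ?s = "(!) l' \<circ> inv_into {..<length l} ((!) l)"
  have "bij_betw ?s V V" using b by (intro bij_betw_trans[of _ V "{..<length l}"] bij_betw_inv_into)
  moreover have "map ?s l = l'"
    using len b(1) by (intro nth_equalityI) (auto simp: inv_into_f_f bij_betw_def)
  ultimately show ?thesis by blast
qed

lemma pattern_measure_eq:
  assumes "l \<in> permutations_of_set V" "l' \<in> permutations_of_set V"
  shows "measure unif_weights {x \<in> space unif_weights. pattern l Q x} = measure unif_weights {x \<in> space unif_weights. pattern l' Q' x}"
proof -
  obtain \<sigma> where s: "bij_betw \<sigma> V V" "map \<sigma> l = l'" using ex_bij_map[OF assms] by auto
  have sV: "\<sigma> \<in> V \<rightarrow> V" using s by (auto simp: bij_betw_def)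
  have l: "set l = V" using assms by (auto simp: permutations_of_set_def)
  \<comment> \<open>Reflect exactly where the sign prescribed by \<open>Q\<close> at
    \<open>v\<close> differs from the one prescribed by \<open>Q'\<close> at
    \<open>\<sigma> v\<close>; the order is unaffected by reflections.\<close>
  define F where "F = {v \<in> V. (v \<in> Q) \<noteq> (\<sigma> v \<in> Q')}"
  have "measure unif_weights {x \<in> space unif_weights. pattern l Q x} = measure (distr unif_weights unif_weights (sym_map V \<sigma> F)) {x \<in> space unif_weights. pattern l Q x}"
    by (simp add: distr_sym_map s)
  also have "\<dots> = measure unif_weights (sym_map V \<sigma> F -` {x \<in> space unif_weights. pattern l Q x} \<inter> space unif_weights)"
    by (intro measure_distr sym_map_measurable sV pattern_sets) (simp add: l)
  also have "sym_map V \<sigma> F -` {x \<in> space unif_weights. pattern l Q x} \<inter> space unif_weights = {x \<in> space unif_weights. pattern l' Q' x}"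
  proof -
    have "pattern l Q (sym_map V \<sigma> F x) \<longleftrightarrow> pattern l' Q' x" for x
    proof -
      have hd: "half_dist (sym_map V \<sigma> F x v) = half_dist (x (\<sigma> v))" if "v \<in> V" for v
        using that by (simp add: sym_map_def half_dist_def min.commute)
      have "sorted_wrt (\<lambda>u v. half_dist (sym_map V \<sigma> F x u) < half_dist (sym_map V \<sigma> F x v)) l \<longleftrightarrow>
        sorted_wrt (\<lambda>u v. half_dist (x (\<sigma> u)) < half_dist (x (\<sigma> v))) l"
        using hd l by (auto simp: sorted_wrt_iff_nth_less)
      also have "\<dots> \<longleftrightarrow> sorted_wrt (\<lambda>u v. half_dist (x u) < half_dist (x v)) l'"
        unfolding s(2)[symmetric] sorted_wrt_map ..
      finally have 1: "sorted_wrt (\<lambda>u v. half_dist (sym_map V \<sigma> F x u) < half_dist (sym_map V \<sigma> F x v)) l \<longleftrightarrow> 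
         sorted_wrt (\<lambda>u v. half_dist (x u) < half_dist (x v)) l'" .
      have "(\<forall>v\<in>V. if v \<in> Q then sym_map V \<sigma> F x v > 1/2 else sym_map V \<sigma> F x v < 1/2) \<longleftrightarrow>
        (\<forall>v\<in>V. if \<sigma> v \<in> Q' then x (\<sigma> v) > 1/2 else x (\<sigma> v) < 1/2)"
        by (intro ball_cong refl) (auto simp: sym_map_def F_def)
      also have "\<dots> \<longleftrightarrow> (\<forall>v\<in>\<sigma> ` V. if v \<in> Q' then x v > 1/2 else x v < 1/2)" by simp
      also have "\<sigma> ` V = V" using s by (simp add: bij_betw_def)
      finally show ?thesis using 1 unfolding pattern_def by simp
    qed
    moreover have "sym_map V \<sigma> F x \<in> space unif_weights" if "x \<in> space unif_weights" for x
      using measurable_space[OF sym_map_measurable[OF sV]] that by blast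
    ultimately show ?thesis by auto
  qed
  finally show ?thesis .
qed

lemma pattern_unique:
  assumes "l \<in> permutations_of_set V" "l' \<in> permutations_of_set V" "Q \<subseteq> V" "Q' \<subseteq> V"
    "pattern l Q x" "pattern l' Q' x"
  shows "l = l'" "Q = Q'"
proof -
  let ?h = "\<lambda>v. half_dist (x v)"
  have l: "set l = V" "set l' = V" using assms(1,2) by (simp_all add: permutations_of_set_def)
  have s: "sorted_wrt (<) (map ?h l)" "sorted_wrt (<) (map ?h l')"
    using assms(5,6) by (auto simp: pattern_def sorted_wrt_map)
  then have "map ?h l = map ?h l'" using l by (intro strict_sorted_equal) auto
  moreover have "inj_on ?h (set l \<union> set l')"
    using s(1) l by (simp add: strict_sorted_iff distinct_map)
  ultimately show "l = l'" by (simp add: inj_on_map_eq_map)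
  have "v \<in> Q \<longleftrightarrow> v \<in> Q'" if "v \<in> V" for v
  proof -
    have "if v \<in> Q then x v > 1/2 else x v < 1/2" "if v \<in> Q' then x v > 1/2 else x v < 1/2"
      using assms(5,6) that unfolding pattern_def by blast+
    then show ?thesis by (auto split: if_splits)
  qed
  then show "Q = Q'" using assms by blast
qed

lemma pattern_exists:
  assumes "generic x"
  shows "\<exists>l\<in>permutations_of_set V. pattern l {v \<in> V. x v > 1/2} x"
proof -
  let ?h = "\<lambda>v. half_dist (x v)"
  obtain l0 where l0: "set l0 = V" "distinct l0" using finite_distinct_list[OF finV] by auto
  define l where "l = sort_key ?h l0"
  have "set l = V" "distinct l" using l0 by (simp_all add: l_def)
  moreover have "sorted_wrt (<) (map ?h l)"
    using assms \<open>set l = V\<close> \<open>distinct l\<close> by (simp add: strict_sorted_iff distinct_map generic_def) (simp add: l_def)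
  ultimately show ?thesis
    using assms by (intro bexI[of _ l]) (auto simp: pattern_def sorted_wrt_map generic_def permutations_of_set_def not_less le_less)
qed

text \<open>There are \<open>fact (card V) * 2 ^ card V\<close> patterns, disjoint and equally
  likely, of total probability at most 1.\<close>

lemma pattern_measure_le:
  assumes "l \<in> permutations_of_set V" "Q \<subseteq> V"
  shows "measure unif_weights {x \<in> space unif_weights. pattern l Q x} \<le> 1 / (fact (card V) * 2 ^ card V)"
proof -
  let ?C = "\<lambda>(l, Q). {x \<in> space unif_weights. pattern l Q x}"
  let ?I = "permutations_of_set V \<times> Pow V"
  have fI: "finite ?I" using finV by simp
  have "(\<Sum>i\<in>?I. measure unif_weights (?C i)) = measure unif_weights (\<Union>i\<in>?I. ?C i)"
  proof (rule P.finite_measure_finite_Union[symmetric, OF fI])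
    show "?C ` ?I \<subseteq> sets unif_weights" using pattern_sets permutations_of_setD(1) by fastforce
    show "disjoint_family_on ?C ?I"
      unfolding disjoint_family_on_def
    proof (intro ballI impI)
      fix i j assume ij: "i \<in> ?I" "j \<in> ?I" "i \<noteq> j"
      obtain l Q l' Q' where e: "i = (l, Q)" "j = (l', Q')" by (cases i, cases j) auto
      have "\<not> (pattern l Q x \<and> pattern l' Q' x)" for x
        using pattern_unique[of l l' Q Q' x] ij e by auto
      then show "?C i \<inter> ?C j = {}" unfolding e by auto
    qed
  qed
  also have "\<dots> \<le> 1" by simp
  finally have "(\<Sum>i\<in>?I. measure unif_weights (?C i)) \<le> 1" .
  moreover have "(\<Sum>i\<in>?I. measure unif_weights (?C i)) = (\<Sum>i\<in>?I. measure unif_weights {x \<in> space unif_weights. pattern l Q x})"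
    using pattern_measure_eq[OF _ assms(1)] by (intro sum.cong) auto
  ultimately have "fact (card V) * 2 ^ card V * measure unif_weights {x \<in> space unif_weights. pattern l Q x} \<le> 1"
    using finV by (simp add: card_cartesian_product card_Pow)
  then show ?thesis by (simp add: field_simps)
qed

text \<open>Passes from weights to counting: up to a null set, \<open>S\<close> is covered by the
  patterns that satisfy \<open>R\<close>.\<close>

lemma measure_le_patterns:
  assumes S: "S \<in> sets unif_weights"
    and R: "\<And>x l Q. x \<in> S \<Longrightarrow> l \<in> permutations_of_set V \<Longrightarrow> Q \<subseteq> V \<Longrightarrow> pattern l Q x \<Longrightarrow> R l Q"
  shows "measure unif_weights S \<le> (\<Sum>l\<in>permutations_of_set V. \<Sum>Q\<in>Pow V. of_bool (R l Q)) / (fact (card V) * 2 ^ card V)"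
proof -
  let ?C = "\<lambda>(l, Q). {x \<in> space unif_weights. pattern l Q x}"
  let ?I = "{i \<in> permutations_of_set V \<times> Pow V. R (fst i) (snd i)}"
  have fI: "finite ?I" using finV by simp
  have C: "?C ` ?I \<subseteq> sets unif_weights" using pattern_sets permutations_of_setD(1) by fastforce
  have "measure unif_weights S \<le> measure unif_weights (\<Union>i\<in>?I. ?C i)"
  proof (rule P.finite_measure_mono_AE)
    show "AE x in unif_weights. x \<in> S \<longrightarrow> x \<in> (\<Union>i\<in>?I. ?C i)"
      using AE_generic
    proof eventually_elim
      case (elim x)
      show ?case
      proof
        assume x: "x \<in> S"
        obtain l where l: "l \<in> permutations_of_set V" "pattern l {v \<in> V. x v > 1/2} x"
          using pattern_exists[OF elim] by auto
        moreover have "R l {v \<in> V. x v > 1/2}" using R[OF x l(1) _ l(2)] by auto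
        moreover have "x \<in> space unif_weights" using x S sets.sets_into_space by blast
        ultimately show "x \<in> (\<Union>i\<in>?I. ?C i)"
          by (intro UN_I[of "(l, {v \<in> V. x v > 1/2})"]) auto
      qed
    qed
    show "(\<Union>i\<in>?I. ?C i) \<in> sets unif_weights" using C fI by (intro sets.finite_UN) auto
  qed
  also have "\<dots> \<le> (\<Sum>i\<in>?I. measure unif_weights (?C i))"
    using C fI by (intro P.finite_measure_subadditive_finite) auto
  also have "\<dots> \<le> (\<Sum>i\<in>?I. 1 / (fact (card V) * 2 ^ card V))"
    using pattern_measure_le by (intro sum_mono) auto
  also have "\<dots> = (\<Sum>i\<in>permutations_of_set V \<times> Pow V. of_bool (R (fst i) (snd i))) / (fact (card V) * 2 ^ card V)"
    using finV unfolding sum_divide_distrib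
    by (subst sum.inter_filter) (auto intro!: sum.cong)
  also have "(\<Sum>i\<in>permutations_of_set V \<times> Pow V. of_bool (R (fst i) (snd i)) :: real) = (\<Sum>l\<in>permutations_of_set V. \<Sum>Q\<in>Pow V. of_bool (R l Q))"
    by (simp add: sum.cartesian_product case_prod_unfold)
  finally show ?thesis .
qed

end

section \<open>Degrees in the irregular random subgraph\<close>

definition nbrs :: "'a set set \<Rightarrow> 'a \<Rightarrow> 'a set" where
  "nbrs E v = {u. {v, u} \<in> E}"

lemma
  assumes "simple_graph V E"
  shows nbrs_subset: "nbrs E v \<subseteq> V"
    and nbrs_irrefl: "v \<notin> nbrs E v"
    and degree_eq_card_nbrs: "degree E v = card (nbrs E v)"
    and simple_irregular_subgraph: "simple_graph V (irregular_subgraph E x)"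
    and nbrs_irregular_subgraph: "nbrs (irregular_subgraph E x) v = {u \<in> nbrs E v. x v + x u \<ge> 1}"
proof -
  have E: "e \<subseteq> V" "card e = 2" if "e \<in> E" for e using assms that by (auto simp: simple_graph_def)
  show "nbrs E v \<subseteq> V" "v \<notin> nbrs E v" using E by (force simp: nbrs_def)+
  have "bij_betw (\<lambda>u. {v, u}) (nbrs E v) {e \<in> E. v \<in> e}"
  proof (rule bij_betwI')
    fix e assume e: "e \<in> {e \<in> E. v \<in> e}"
    then obtain a b where "e = {a, b}" "a \<noteq> b" using E(2)[of e] unfolding card_2_iff by blast
    then show "\<exists>u\<in>nbrs E v. e = {v, u}" using e by (auto simp: nbrs_def insert_commute)
  qed (auto simp: nbrs_def doubleton_eq_iff)
  then show "degree E v = card (nbrs E v)" by (simp add: degree_def bij_betw_same_card)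
  show "simple_graph V (irregular_subgraph E x)"
    using assms by (auto simp: simple_graph_def irregular_subgraph_def)
  show "nbrs (irregular_subgraph E x) v = {u \<in> nbrs E v. x v + x u \<ge> 1}"
    by (auto simp: nbrs_def irregular_subgraph_def doubleton_eq_iff add.commute insert_commute)
qed

lemma regular_nbhds_nbrs:
  assumes "regular_graph d V E"
  shows "regular_nbhds V (nbrs E) d"
proof
  have s: "simple_graph V E" using assms by (simp add: regular_graph_def)
  show "finite V" using s by (simp add: simple_graph_def)
  show "nbrs E v \<subseteq> V" "v \<notin> nbrs E v" for v using nbrs_subset[OF s] nbrs_irrefl[OF s] by auto
  show "(u \<in> nbrs E v) = (v \<in> nbrs E u)" for u v by (simp add: nbrs_def insert_commute)
  show "card (nbrs E v) = d" if "v \<in> V" for v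
    using assms that degree_eq_card_nbrs[OF s] by (simp add: regular_graph_def)
qed

lemma num_of_degree_eq:
  assumes "simple_graph V E"
  shows "num_of_degree V (irregular_subgraph E x) k = card {v \<in> V. card {u \<in> nbrs E v. x v + x u \<ge> 1} = k}"
  unfolding num_of_degree_def
  using degree_eq_card_nbrs[OF simple_irregular_subgraph[OF assms]] nbrs_irregular_subgraph[OF assms] by simp

lemma num_of_degree_measurable:
  assumes "simple_graph V E"
  shows "(\<lambda>x. real (num_of_degree V (irregular_subgraph E x) k)) \<in> borel_measurable (PiM V (\<lambda>_. std_uniform))"
proof -
  have fV: "finite V" using assms by (simp add: simple_graph_def)
  note sub = nbrs_subset[OF assms]
  have fN: "finite (nbrs E v)" for v using sub fV finite_subset by blast
  have m: "(\<lambda>x. x v) \<in> borel_measurable (PiM V (\<lambda>_. std_uniform))" if "v \<in> V" for v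
    using that measurable_component_singleton[of v V "\<lambda>_. std_uniform"] by (simp cong: measurable_cong_sets)
  \<comment> \<open>Both cardinalities become finite sums of indicators, to which measurability
    rules apply.\<close>
  have eq: "real (num_of_degree V (irregular_subgraph E x) k) =
      (\<Sum>v\<in>V. if (\<Sum>u\<in>nbrs E v. if x v + x u \<ge> 1 then 1 else 0) = real k then 1 else 0)" for x
    unfolding num_of_degree_eq[OF assms] using fV fN by (simp add: sum.If_cases Int_def)
  have "(\<lambda>x. (\<Sum>u\<in>nbrs E v. if x v + x u \<ge> 1 then 1 else 0 :: real)) \<in> borel_measurable (PiM V (\<lambda>_. std_uniform))"
    if "v \<in> V" for v
  proof (rule borel_measurable_sum)
    fix u assume "u \<in> nbrs E v"
    then have [measurable]: "(\<lambda>x. x u) \<in> borel_measurable (PiM V (\<lambda>_. std_uniform))" "(\<lambda>x. x v) \<in> borel_measurable (PiM V (\<lambda>_. std_uniform))"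
      using m sub that by blast+
    show "(\<lambda>x. if x v + x u \<ge> 1 then 1 else 0 :: real) \<in> borel_measurable (PiM V (\<lambda>_. std_uniform))"
      by measurable
  qed
  then show ?thesis unfolding eq by measurable
qed

text \<open>If \<open>x u > 1/2\<close>, then
  \<open>1 - x u = half_dist (x u) < half_dist (x v) \<le> x v\<close>. If \<open>x u < 1/2\<close>,
  then \<open>x u < half_dist (x v) \<le> 1 - x v\<close>.\<close>

lemma pattern_edge:
  assumes "finite V" "pattern V l Q x" "u \<in> V" "v \<in> V" "half_dist (x u) < half_dist (x v)"
  shows "x u + x v \<ge> 1 \<longleftrightarrow> u \<in> Q"
proof -
  have "if u \<in> Q then x u > 1/2 else x u < 1/2" "if v \<in> Q then x v > 1/2 else x v < 1/2"
    using assms(2-4) unfolding pattern_def[OF assms(1)] by blast+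
  then show ?thesis using assms(5) by (auto simp: half_dist_def min_def split: if_splits)
qed

text \<open>The prefix \<open>xs\<close> of exposed vertices makes the induction go through: the
  accumulator is then \<open>Q \<inter> set xs\<close>.\<close>

lemma count_degree_suffix:
  assumes fV: "finite V" and sub: "\<And>v. N v \<subseteq> V" and irr: "\<And>v. v \<notin> N v"
    and pat: "pattern V (xs @ l) Q x" and perm: "xs @ l \<in> permutations_of_set V" and Q: "Q \<subseteq> V"
  shows "count_degree N k Q (Q \<inter> set xs) l = card {v \<in> set l. card {u \<in> N v. x v + x u \<ge> 1} = k}"
  using pat perm
proof (induction l arbitrary: xs)
  case (Cons w l)
  have V: "V = insert w (set xs \<union> set l)" and dist: "w \<notin> set xs" "w \<notin> set l" "set xs \<inter> set l = {}"
    using Cons.prems(2) by (auto simp: permutations_of_set_def)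
  have sorted: "sorted_wrt (\<lambda>u v. half_dist (x u) < half_dist (x v)) (xs @ w # l)"
    using Cons.prems(1) by (simp add: pattern_def[OF fV])
  have e1: "x u + x w \<ge> 1 \<longleftrightarrow> u \<in> Q" if "u \<in> set xs" for u
    using that sorted V by (intro pattern_edge[OF fV Cons.prems(1)]) (auto simp: sorted_wrt_append)
  have e2: "x w + x u \<ge> 1 \<longleftrightarrow> w \<in> Q" if "u \<in> set l" for u
    using that sorted V by (intro pattern_edge[OF fV Cons.prems(1)]) (auto simp: sorted_wrt_append)
  \<comment> \<open>Earlier neighbours are joined to \<open>w\<close> by their own sign, later ones
    all together by the sign of \<open>w\<close>.\<close>
  have "{u \<in> N w. x w + x u \<ge> 1} = N w \<inter> (Q \<inter> set xs) \<union> (if w \<in> Q then N w \<inter> set l else {})"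
    using sub[of w] irr[of w] V e1 e2 by (auto simp: add.commute)
  also have "card \<dots> = card (N w \<inter> (Q \<inter> set xs)) + (if w \<in> Q then card (N w \<inter> set l) else 0)"
    using dist by (auto intro!: card_Un_disjoint)
  finally have deg: "card {u \<in> N w. x w + x u \<ge> 1} = card (N w \<inter> (Q \<inter> set xs)) + (if w \<in> Q then card (N w \<inter> set l) else 0)" .
  have IH: "count_degree N k Q (Q \<inter> set (xs @ [w])) l = card {v \<in> set l. card {u \<in> N v. x v + x u \<ge> 1} = k}"
    using Cons.IH[of "xs @ [w]"] Cons.prems by simp
  have "Q \<inter> set (xs @ [w]) = (if w \<in> Q then insert w (Q \<inter> set xs) else Q \<inter> set xs)" by auto
  with IH have "count_degree N k Q (Q \<inter> set xs) (w # l) =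
      of_bool (card {u \<in> N w. x w + x u \<ge> 1} = k) + card {v \<in> set l. card {u \<in> N v. x v + x u \<ge> 1} = k}"
    unfolding deg by simp
  also have "\<dots> = card {v \<in> set (w # l). card {u \<in> N v. x v + x u \<ge> 1} = k}"
  proof -
    have "{v \<in> set (w # l). card {u \<in> N v. x v + x u \<ge> 1} = k} =
      (if card {u \<in> N w. x w + x u \<ge> 1} = k then {w} else {}) \<union> {v \<in> set l. card {u \<in> N v. x v + x u \<ge> 1} = k}"
      by auto
    then show ?thesis using dist by simp
  qed
  finally show ?case .
qed simp

lemma num_of_degree_pattern:
  assumes "simple_graph V E" "pattern V l Q x" "l \<in> permutations_of_set V" "Q \<subseteq> V"
  shows "num_of_degree V (irregular_subgraph E x) k = count_degree (nbrs E) k Q {} l"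
proof -
  have fV: "finite V" using assms by (simp add: simple_graph_def)
  have "set l = V" using assms by (simp add: permutations_of_set_def)
  then show ?thesis
    using count_degree_suffix[OF fV nbrs_subset[OF assms(1)] nbrs_irrefl[OF assms(1)], of "[]" l Q x k] assms
    by (simp add: num_of_degree_eq)
qed

section \<open>Choice of parameters and the final probability bounds\<close>

lemma degree_count_deviation:
  fixes n :: nat and L :: real
  assumes reg: "regular_graph d V E" and n: "card V = n" and L: "L = ln (real n)" "L \<ge> 4"
    and d: "real (d + 1) * L ^ 12 \<le> real n" and k: "k \<le> d"
  shows "measure (vertex_weights V) {x \<in> space (vertex_weights V).
      \<bar>real (num_of_degree V (irregular_subgraph E x) k) - real n / real (d + 1)\<bar> > 1 / L * (real n / real (d + 1))}
    \<le> 5 / real n ^ 3"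
proof -
  have simple: "simple_graph V E" using reg by (simp add: regular_graph_def)
  have fV: "finite V" using simple by (simp add: simple_graph_def)
  \<comment> \<open>\<open>ln 0 = 0\<close> contradicts \<open>L \<ge> 4\<close>.\<close>
  have n0: "n > 0" using L by (cases n) auto
  have ne: "V \<noteq> {}" using n n0 by auto
  have nL: "real n = exp L" using n0 L by simp
  \<comment> \<open>As \<open>ln 2 \<ge> 2/3\<close>, this gives
    \<open>(1/2) ^ K \<le> 1 / n ^ 5\<close>, which beats the \<open>n\<^sup>2\<close> pairs and
    leaves order \<open>1 / n ^ 3\<close>.\<close>
  define K where "K = nat \<lceil>8 * L\<rceil>"
  define J where "J = real K + 1"
  define eps where "eps = 1 / L"
  \<comment> \<open>This makes \<open>th = lam / (8 * L\<^sup>2)\<close>, so the harmonic cost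
    \<open>th * mu * (L + 1)\<close> is only a fraction of the gain
    \<open>lam * eps * mu = lam * mu / L\<close>.\<close>
  define lam where "lam = 1 / (64 * J * L\<^sup>2)"
  define th where "th = 8 * lam\<^sup>2 * J"
  define mu where "mu = real n / real (d + 1)"
  have K_bounds: "8 * L \<le> real K" "real K \<le> 8 * L + 1" using L by (auto simp: K_def)
  have J_bounds: "J \<le> 16 * L" "J \<ge> 1" using K_bounds L by (auto simp: J_def)
  have L2: "L\<^sup>2 \<ge> 1" using L by (simp add: one_le_power)
  have lam0: "lam > 0" using J_bounds L by (simp add: lam_def)
  have lamJ: "lam * J = 1 / (64 * L\<^sup>2)" using J_bounds by (simp add: lam_def)
  have th_eq: "th = lam / (8 * L\<^sup>2)"
  proof -
    have "th = 8 * lam * (lam * J)" by (simp add: th_def power2_eq_square)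
    then show ?thesis unfolding lamJ by simp
  qed
  have lamle: "lam * J \<le> 1/64" using L2 unfolding lamJ by (intro frac_le) auto
  have lam1: "lam \<le> 1/64" 
    using order_trans[OF mult_left_mono[OF J_bounds(2), of lam] lamle] lam0 by simp
  have thle: "th \<le> lam" using lam0 L2 frac_le[of lam lam 1 "8 * L\<^sup>2"] unfolding th_eq by simp
  interpret regular_nbhds_params V "nbrs E" d K lam eps mu th J
  proof (intro regular_nbhds_params.intro regular_nbhds_nbrs[OF reg], unfold_locales)
    show "K > 0" using K_bounds L by (cases K) auto
    show "J = real K + 1" "th = 8 * lam\<^sup>2 * J" by (simp_all add: J_def th_def)
    show "th \<le> 1/4" "th \<le> lam" "lam * J \<le> 1/2" using thle lam1 lamle by auto
    show "0 \<le> eps" "eps \<le> 1" "0 \<le> mu" using L by (auto simp: eps_def mu_def)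
  qed
  let ?S = "{x \<in> space (PiM V (\<lambda>_. std_uniform)). \<bar>real (num_of_degree V (irregular_subgraph E x) k) - mu\<bar> > eps * mu}"
  \<comment> \<open>The \<open>0 +\<close> is the starting count \<open>c = 0\<close> of
    \<open>average_le_deviation_bound\<close>.\<close>
  let ?R = "\<lambda>l Q. \<bar>0 + real (count_degree (nbrs E) k Q {} l) - mu\<bar> > eps * mu"
  have S: "?S \<in> sets (PiM V (\<lambda>_. std_uniform))"
    using num_of_degree_measurable[OF simple] by measurable
  have "measure (PiM V (\<lambda>_. std_uniform)) ?S \<le>
      (\<Sum>l\<in>permutations_of_set V. \<Sum>Q\<in>Pow V. of_bool (?R l Q)) / (fact (card V) * 2 ^ card V)"
    by (rule measure_le_patterns[OF fV S]) (auto simp: num_of_degree_pattern[OF simple])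
  also have "\<dots> \<le> fact (card V) * 2 ^ card V * deviation_bound k V {} 0 / (fact (card V) * 2 ^ card V)"
    by (intro divide_right_mono average_le_deviation_bound) (use fV in auto)
  also have "\<dots> = deviation_bound k V {} 0" by simp
  also have "\<dots> \<le> 2 * exp (th * mu - (lam - th) * (eps * mu) + th * mu * (ln (real (card V)) + 1)) +
    exp 1 * (real (card V))\<^sup>2 * (1/2) ^ K"
    by (rule deviation_bound_initial[OF _ k ne]) (simp add: mu_def n)
  also have "\<dots> \<le> 2 / real n ^ 3 + 3 / real n ^ 3"
  proof (rule add_mono)
    have mu: "mu \<ge> L ^ 12" using d by (simp add: mu_def field_simps)
    define a where "a = 1 / L"
    have a: "a * L = 1" "0 < a" "a \<le> 1" using L(2) by (auto simp: a_def)
    have apow: "a\<^sup>2 \<le> a" "a ^ 3 \<le> a"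
      using a power_decreasing[of 1 2 a] power_decreasing[of 1 3 a] by auto
    have th_a: "th = lam * a\<^sup>2 / 8" by (simp add: th_eq a_def power_divide)
    have "th * mu - (lam - th) * (eps * mu) + th * mu * (ln (real (card V)) + 1) =
       mu * lam * (a\<^sup>2 / 4 + a ^ 3 / 8 + a * (a * L) / 8 - a)"
      unfolding th_a n L(1)[symmetric] eps_def a_def[symmetric]
      by (simp add: field_simps power2_eq_square power3_eq_cube)
    also have "\<dots> \<le> mu * lam * (- (a / 2))"
      unfolding a(1) using apow lam0 by (intro mult_left_mono) (auto simp: mu_def)
    \<comment> \<open>From \<open>mu \<ge> L ^ 12\<close> and
      \<open>lam \<ge> 1 / (1024 * L ^ 3)\<close> the exponent is at most
      \<open>- (L ^ 8 / 2048)\<close>, and \<open>L \<ge> 4\<close> gives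
      \<open>L ^ 7 \<ge> 4 ^ 7 = 8 * 2048\<close>.\<close>
    also have "\<dots> \<le> - 3 * L"
    proof -
      have "1 / (1024 * L ^ 3) \<le> lam"
      proof -
        have "64 * J * L\<^sup>2 \<le> 1024 * L ^ 3" 
          using mult_right_mono[OF J_bounds(1), of "L\<^sup>2"] L by (simp add: power3_eq_cube power2_eq_square)
        then show ?thesis unfolding lam_def using J_bounds L by (intro divide_left_mono) auto
      qed
      then have "L ^ 12 * (1 / (1024 * L ^ 3)) \<le> mu * lam"
        using mu L by (intro mult_mono) (auto simp: mu_def)
      moreover have "L ^ 12 * (1 / (1024 * L ^ 3)) = L ^ 9 / 1024"
      proof -
        have "x * y * (1 / (1024 * y)) = x / 1024" if "y > 0" for x y :: real using that by simp
        from this[of "L ^ 3" "L ^ 9"] show ?thesis using L(2) by (simp only: power_add[symmetric]) simp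
      qed
      ultimately have "L ^ 9 / 1024 \<le> mu * lam" by simp
      then have 1: "L ^ 9 / 1024 * (a / 2) \<le> mu * lam * (a / 2)"
        using a by (intro mult_right_mono) auto
      have "L ^ 9 * a = L ^ 8" using L(2) power_Suc[of L 8] by (simp add: a_def)
      then have "L ^ 9 / 1024 * (a / 2) = L ^ 8 / 2048" by simp
      moreover have "(4::real) ^ 7 \<le> L ^ 7" using L by (intro power_mono) auto
      then have "L * 4 ^ 7 \<le> L * L ^ 7" using L(2) by (intro mult_left_mono) auto
      then have "3 * L \<le> L ^ 8 / 2048" using L(2) power_Suc[of L 7] by simp
      ultimately show ?thesis using 1 by simp
    qed
    finally have "exp (th * mu - (lam - th) * (eps * mu) + th * mu * (ln (real (card V)) + 1)) \<le> exp (- 3 * L)" by simp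
    also have "\<dots> = 1 / real n ^ 3" unfolding nL by (simp add: exp_minus field_simps flip: exp_of_nat_mult)
    finally show "2 * exp (th * mu - (lam - th) * (eps * mu) + th * mu * (ln (real (card V)) + 1)) \<le> 2 / real n ^ 3" by simp
    have "(1/2::real) ^ K = exp (- real K * ln 2)" by (simp add: exp_minus exp_of_nat_mult power_one_over inverse_eq_divide)
    also have "\<dots> \<le> exp (- 5 * L)"
    proof -
      have "(8 * L) * (2/3) \<le> real K * ln 2" using K_bounds ln2_ge_two_thirds L by (intro mult_mono) auto
      then show ?thesis using L by simp
    qed
    also have "\<dots> = 1 / real n ^ 5" unfolding nL by (simp add: exp_minus field_simps flip: exp_of_nat_mult)
    finally have "exp 1 * (real n)\<^sup>2 * (1/2) ^ K \<le> 3 * (real n)\<^sup>2 * (1 / real n ^ 5)"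
      using exp_le by (intro mult_mono) auto
    also have "\<dots> = 3 / real n ^ 3" using n0 by (simp add: field_simps flip: power_add)
    finally show "exp 1 * (real (card V))\<^sup>2 * (1/2) ^ K \<le> 3 / real n ^ 3" by (simp add: n)
  qed
  finally show ?thesis by (simp add: vertex_weights_eq eps_def mu_def)
qed

text \<open>Union bound over the \<open>d + 1 \<le> n\<close> possible degrees, each failing with
  probability at most \<open>5 / n ^ 3\<close>.\<close>

lemma degree_counts_concentrated:
  fixes n :: nat and L :: real
  assumes reg: "regular_graph d V E" and n: "card V = n" and L: "L = ln (real n)" "L \<ge> 4"
    and d: "real (d + 1) * L ^ 12 \<le> real n"
  shows "\<P>(x in vertex_weights V. \<forall>k\<le>d.
      \<bar>real (num_of_degree V (irregular_subgraph E x) k) - real n / real (d + 1)\<bar>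
        \<le> 1 / L * (real n / real (d + 1))) \<ge> 1 - 5 / (real n)\<^sup>2"
proof -
  have simple: "simple_graph V E" using reg by (simp add: regular_graph_def)
  have n0: "n > 0" using L by (cases n) auto
  let ?M = "vertex_weights V"
  let ?D = "\<lambda>k x. \<bar>real (num_of_degree V (irregular_subgraph E x) k) - real n / real (d + 1)\<bar>"
  let ?t = "1 / L * (real n / real (d + 1))"
  let ?B = "\<lambda>k. {x \<in> space ?M. ?D k x > ?t}"
  interpret prob_space ?M
    unfolding vertex_weights_eq by (intro prob_space_PiM prob_space_std_uniform)
  have B: "?B k \<in> events" for k
    unfolding vertex_weights_eq using num_of_degree_measurable[OF simple, of k] by measurable
  have "1 \<le> L ^ 12" using L by (intro one_le_power) auto
  then have "real (d + 1) * 1 \<le> real (d + 1) * L ^ 12" by (intro mult_left_mono) auto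
  then have dn: "real (d + 1) \<le> real n" using order_trans[OF _ d] by simp
  have "prob (\<Union>k\<in>{..d}. ?B k) \<le> (\<Sum>k\<in>{..d}. prob (?B k))"
    by (intro finite_measure_subadditive_finite image_subsetI B finite_atMost)
  also have "\<dots> \<le> (\<Sum>k\<in>{..d}. 5 / real n ^ 3)"
    using degree_count_deviation[OF reg n L d] by (intro sum_mono) auto
  also have "\<dots> = real (d + 1) * (5 / real n ^ 3)" by simp
  also have "\<dots> \<le> real n * (5 / real n ^ 3)" using dn by (intro mult_right_mono) auto
  also have "\<dots> = 5 / (real n)\<^sup>2" using n0 by (simp add: power2_eq_square power3_eq_cube)
  finally have "prob (\<Union>k\<in>{..d}. ?B k) \<le> 5 / (real n)\<^sup>2" .
  moreover have "{x \<in> space ?M. \<forall>k\<le>d. ?D k x \<le> ?t} = space ?M - (\<Union>k\<in>{..d}. ?B k)"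
    by (auto simp: not_less)
  moreover have "prob (space ?M - (\<Union>k\<in>{..d}. ?B k)) = 1 - prob (\<Union>k\<in>{..d}. ?B k)"
    by (intro prob_compl sets.finite_UN B finite_atMost)
  ultimately show ?thesis by simp
qed

text \<open>The error \<open>\<epsilon>\<close> depends on \<open>n\<close> alone, so the o(1) is
  uniform over all graphs and all \<open>k\<close>.\<close>

theorem theorem1p3:
  fixes d :: "nat \<Rightarrow> nat"
  assumes "(\<lambda>n. real (d n)) \<in> o(\<lambda>n. real n / (ln (real n)) ^ 12)"
  shows "\<exists>\<epsilon> :: nat \<Rightarrow> real. \<epsilon> \<longlonglongrightarrow> 0 \<and>
    (\<forall>\<eta>>0. \<forall>\<^sub>F n in sequentially. \<forall>(V :: 'a set) E.
      card V = n \<and> regular_graph (d n) V E \<longrightarrow>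
      \<P>(x in vertex_weights V. \<forall>k\<le>d n.
          \<bar>real (num_of_degree V (irregular_subgraph E x) k) - real n / real (d n + 1)\<bar>
            \<le> \<epsilon> n * (real n / real (d n + 1))) \<ge> 1 - \<eta>)"
proof (intro exI conjI allI impI)
  have ln_top: "filterlim (\<lambda>n. ln (real n)) at_top sequentially"
    by (rule filterlim_compose[OF ln_at_top filterlim_real_sequentially])
  \<comment> \<open>The witness \<open>1 / ln n\<close> is the relative deviation
    \<open>1 / L\<close> of \<open>degree_counts_concentrated\<close>.\<close>
  show "(\<lambda>n. 1 / ln (real n)) \<longlonglongrightarrow> 0"
    using tendsto_inverse_0_at_top[OF ln_top] by (simp add: inverse_eq_divide)
  fix \<eta> :: real assume eta: "\<eta> > 0"
  have 1: "\<forall>\<^sub>F n in sequentially. ln (real n) \<ge> 4"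
    using ln_top by (simp add: filterlim_at_top)
  \<comment> \<open>To obtain \<open>(d n + 1) * ln n ^ 12 \<le> n\<close>, half of \<open>n\<close>
    is spent on \<open>d n\<close> here and the other half on the \<open>+ 1\<close> in fact
    \<open>3\<close>.\<close>
  have 2: "\<forall>\<^sub>F n in sequentially. norm (real (d n)) \<le> 1/2 * norm (real n / ln (real n) ^ 12)"
    using landau_o.smallD[OF assms, of "1/2"] by simp
  have "((\<lambda>n. ln (real n) ^ 12 / exp (ln (real n))) \<longlongrightarrow> 0) sequentially"
    by (rule filterlim_compose[OF tendsto_power_div_exp_0 ln_top])
  then have 3: "\<forall>\<^sub>F n in sequentially. ln (real n) ^ 12 / exp (ln (real n)) < 1/2"
    by (rule order_tendstoD) simp
  have "((\<lambda>n. 5 / (real n)\<^sup>2) \<longlongrightarrow> 0) sequentially"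
    by (intro tendsto_divide_0[OF tendsto_const] filterlim_at_top_imp_at_infinity
        filterlim_pow_at_top filterlim_real_sequentially) simp
  then have 4: "\<forall>\<^sub>F n in sequentially. 5 / (real n)\<^sup>2 < \<eta>"
    using eta by (rule order_tendstoD)
  show "\<forall>\<^sub>F n in sequentially. \<forall>(V :: 'a set) E.
      card V = n \<and> regular_graph (d n) V E \<longrightarrow>
      \<P>(x in vertex_weights V. \<forall>k\<le>d n.
          \<bar>real (num_of_degree V (irregular_subgraph E x) k) - real n / real (d n + 1)\<bar>
            \<le> 1 / ln (real n) * (real n / real (d n + 1))) \<ge> 1 - \<eta>"
    using 1 2 3 4
  proof eventually_elim
    case (elim n)
    have n: "n > 0" using elim by (cases n) auto
    have "ln (real n) ^ 12 > 0" using elim by simp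
    then have "real (d n + 1) * ln (real n) ^ 12 \<le> real n"
      using elim n by (simp add: field_simps)
    then have "1 - 5 / (real n)\<^sup>2 \<le> \<P>(x in vertex_weights V. \<forall>k\<le>d n.
          \<bar>real (num_of_degree V (irregular_subgraph E x) k) - real n / real (d n + 1)\<bar>
            \<le> 1 / ln (real n) * (real n / real (d n + 1)))"
      if "card V = n" "regular_graph (d n) V E" for V :: "'a set" and E
      using that elim by (intro degree_counts_concentrated) auto
    then show ?case using elim(4) by force
  qed
qed

end
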